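(* Let $G=(V,E)$ be a finite connected graph with $|V|\ge 2$. For $N\ge 1$ and $k\ge 1$ let $G^{[N,k]}$ be the distance $k$-graph of the $N$-fold Cartesian power $G^N=G\times\cdots\times G$, and let $A^{[N,k]}$ be its adjacency matrix. Then, for each fixed $k\ge 1$, the eigenvalue distribution of $N^{-k/2}A^{[N,k]}$ converges in moments, as $N\to\infty$, to the probability distribution of $$\left(\frac{2|E|}{|V|}\right)^{k/2}\frac{1}{k!}\,\tilde H_k(g),$$ where $\tilde H_k$ is the monic Hermite polynomial of degree $k$ and $g$ is a random variable obeying the standard normal distribution $N(0,1)$. That is, for every $m=1,2,\dots$, $$\lim_{N\to\infty}\frac{1}{|V|^N}\operatorname{Tr}\left[\left(\frac{A^{[N,k]}}{N^{k/2}}\right)^m\right]=\mathbf{E}\left[\left(\left(\frac{2|E|}{|V|}\right)^{k/2}\frac{1}{k!}\tilde H_k(g)\right)^m\right].$$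
   Context: Graphs are undirected, without loops or multiple edges. $\partial_G(x,y)$ denotes the graph distance in $G$. The $N$-fold Cartesian power $G^N$ has vertex set $V^N$, and two vertices $(\xi_1,\dots,\xi_N)$, $(\eta_1,\dots,\eta_N)$ are adjacent if and only if there is an index $i$ with $\{\xi_i,\eta_i\}\in E$ and $\xi_j=\eta_j$ for all $j\ne i$. For a graph $G$ and an integer $k\ge1$, the distance $k$-graph of $G$ is the graph on the same vertex set $V$ in which $\{x,y\}$ is an edge if and only if $\partial_G(x,y)=k$. The eigenvalue distribution of a real symmetric matrix of size $n$ is the probability measure on $\mathbb{R}$ assigning mass $1/n$ to each eigenvalue (counted with multiplicity); its $m$-th moment is the normalized trace of the $m$-th power of the matrix. The monic Hermite polynomials are defined by $\tilde H_0(x)=1$, $\tilde H_1(x)=x$, and $x\tilde H_n(x)=\tilde H_{n+1}(x)+n\tilde H_{n-1}(x)$ for $n\ge 1$. *)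

theory Defs
  imports
    "HOL-Probability.Probability"
    "HOL-Library.Extended_Nat"
    "Jordan_Normal_Form.Char_Poly"
begin

record 'a ugraph =
  verts :: "'a set"
  edges :: "'a set set"

definition finite_simple_graph :: "'a ugraph \<Rightarrow> bool" where
  "finite_simple_graph G \<longleftrightarrow>
     finite (verts G) \<and>
     edges G \<subseteq> {{x, y} | x y. x \<in> verts G \<and> y \<in> verts G \<and> x \<noteq> y}"

text \<open>A walk is given by its nonempty list of vertices; its length is the number of its steps,
  one less than the number of listed vertices.\<close>

definition walks :: "'a ugraph \<Rightarrow> 'a \<Rightarrow> 'a \<Rightarrow> 'a list set" where
  "walks G x y = {p. p \<noteq> [] \<and> set p \<subseteq> verts G \<and> hd p = x \<and> last p = y \<and>
                     successively (\<lambda>u v. {u, v} \<in> edges G) p}"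

definition connected_graph :: "'a ugraph \<Rightarrow> bool" where
  "connected_graph G \<longleftrightarrow> (\<forall>x\<in>verts G. \<forall>y\<in>verts G. walks G x y \<noteq> {})"

text \<open>The distance is \<open>\<infinity>\<close> if there is no walk.\<close>

definition graph_dist :: "'a ugraph \<Rightarrow> 'a \<Rightarrow> 'a \<Rightarrow> enat" where
  "graph_dist G x y = (INF p\<in>walks G x y. enat (length p - 1))"

text \<open>Elements of the \<open>N\<close>-fold power of the vertex set are functions on \<open>{..<N}\<close>
  (extended by \<open>undefined\<close>).\<close>

definition cartesian_power :: "nat \<Rightarrow> 'a ugraph \<Rightarrow> (nat \<Rightarrow> 'a) ugraph" where
  "cartesian_power N G =
     \<lparr>verts = {..<N} \<rightarrow>\<^sub>E verts G,
      edges = {{\<xi>, \<eta>} | \<xi> \<eta>.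
                 \<xi> \<in> {..<N} \<rightarrow>\<^sub>E verts G \<and> \<eta> \<in> {..<N} \<rightarrow>\<^sub>E verts G \<and>
                 (\<exists>i<N. {\<xi> i, \<eta> i} \<in> edges G \<and> (\<forall>j<N. j \<noteq> i \<longrightarrow> \<xi> j = \<eta> j))}\<rparr>"

definition distance_graph :: "nat \<Rightarrow> 'a ugraph \<Rightarrow> 'a ugraph" where
  "distance_graph k G =
     \<lparr>verts = verts G,
      edges = {{x, y} | x y. x \<in> verts G \<and> y \<in> verts G \<and> graph_dist G x y = enat k}\<rparr>"

text \<open>For a finite vertex set \<open>V\<close>, \<open>from_nat_into V\<close> is a bijection from \<open>{..<card V}\<close> to \<open>V\<close>.
  A different enumeration of the vertices conjugates the matrix by a permutation matrix.\<close>

definition adjacency_matrix :: "'a ugraph \<Rightarrow> real mat" where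
  "adjacency_matrix G =
     mat (card (verts G)) (card (verts G))
       (\<lambda>(i, j). if {from_nat_into (verts G) i, from_nat_into (verts G) j} \<in> edges G
                 then 1 else 0)"

definition mat_trace :: "'a :: comm_monoid_add mat \<Rightarrow> 'a" where
  "mat_trace A = (\<Sum>i<dim_row A. A $$ (i, i))"

text \<open>For a real symmetric matrix of size \<open>n > 0\<close> the characteristic polynomial splits over the
  reals, so the multiset of its roots has exactly \<open>n\<close> elements and each eigenvalue receives
  mass \<open>1 / n\<close> per multiplicity. Only such matrices are meant here.\<close>

definition eigenvalue_distribution :: "real mat \<Rightarrow> real pmf" where
  "eigenvalue_distribution A = pmf_of_multiset (proots (char_poly A))"

definition converges_in_moments :: "(nat \<Rightarrow> real measure) \<Rightarrow> real measure \<Rightarrow> bool" where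
  "converges_in_moments \<mu>s \<mu> \<longleftrightarrow>
     (\<forall>m::nat. (\<forall>N. integrable (\<mu>s N) (\<lambda>x. x ^ m)) \<and> integrable \<mu> (\<lambda>x. x ^ m) \<and>
        (\<lambda>N. integral\<^sup>L (\<mu>s N) (\<lambda>x. x ^ m)) \<longlonglongrightarrow> integral\<^sup>L \<mu> (\<lambda>x. x ^ m))"

fun hermite :: "nat \<Rightarrow> real poly" where
  "hermite 0 = 1"
| "hermite (Suc 0) = [:0, 1:]"
| "hermite (Suc (Suc n)) = [:0, 1:] * hermite (Suc n) - Polynomial.smult (real (Suc n)) (hermite n)"

text \<open>At the irrelevant index \<open>N = 0\<close> the scaled matrix is zero, by \<open>1 / 0 = 0\<close>.\<close>

definition scaled_distance_matrix :: "'a ugraph \<Rightarrow> nat \<Rightarrow> nat \<Rightarrow> real mat" where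
  "scaled_distance_matrix G k N =
     (1 / real N powr (real k / 2)) \<cdot>\<^sub>m adjacency_matrix (distance_graph k (cartesian_power N G))"

definition limit_function :: "'a ugraph \<Rightarrow> nat \<Rightarrow> real \<Rightarrow> real" where
  "limit_function G k x =
     (2 * real (card (edges G)) / real (card (verts G))) powr (real k / 2)
       * (1 / fact k) * poly (hermite k) x"

end

theory Submission
  imports
    Defs
    "HOL-Complex_Analysis.Complex_Analysis"
    "Jordan_Normal_Form.Schur_Decomposition"
begin

text \<open>
  A closed sequence of \<open>m\<close> vertices of \<open>G\<^sup>N\<close> consists of \<open>N\<close> independent closed sequences in \<open>G\<close>, and
  distances in \<open>G\<^sup>N\<close> are sums of the distances in the factors. Extracting the condition that all
  consecutive distances equal \<open>k\<close> by Fourier integrals over \<open>s\<^sub>1, \<dots>, s\<^sub>m\<close> on the unit circle turns the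
  normalized trace of the \<open>m\<close>-th power into the integral of \<open>(\<Prod>\<^sub>j s\<^sub>j\<^sup>-\<^sup>k) f\<^sub>N(s)\<^sup>N\<close>, where \<open>f\<^sub>N(s)\<close> is
  the normalized trace of the product over \<open>j\<close> of the matrices with entries \<open>(s\<^sub>j / \<surd>N)\<close> to the power
  \<open>\<partial>(x, y)\<close>. To second order \<open>f\<^sub>N(s) = 1 + c e\<^sub>2(s) / N + O(N\<^sup>-\<^sup>3\<^sup>/\<^sup>2)\<close>, where \<open>c\<close> is the mean degree and
  \<open>e\<^sub>2(s)\<close> the second elementary symmetric function, so the integrand converges boundedly with
  \<open>f\<^sub>N(s)\<^sup>N\<close> tending to \<open>exp (c e\<^sub>2(s))\<close>. This limit is the Gaussian average of the product of the
  \<open>exp (\<surd>c s\<^sub>j g - c s\<^sub>j\<^sup>2 / 2)\<close>, whose coefficient at \<open>s\<^sub>j\<^sup>k\<close> is \<open>c\<^sup>k\<^sup>/\<^sup>2\<close> times the Hermite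
  polynomial of degree \<open>k\<close> at \<open>g\<close> over \<open>k!\<close>.
\<close>

section \<open>Iterated kernels\<close>

text \<open>The entry at (x, y) of the matrix product of \<open>K 0\<close>, ...,
  \<open>K (m - 1)\<close>. The kernel may change from step to step because each step later carries
  its own Fourier variable. A commutative semiring as codomain admits real, complex and polynomial
  entries alike.\<close>

primrec kernel_chain ::
    "'x set \<Rightarrow> (nat \<Rightarrow> 'x \<Rightarrow> 'x \<Rightarrow> 'b::comm_semiring_1) \<Rightarrow> nat \<Rightarrow> 'x \<Rightarrow> 'x \<Rightarrow> 'b" where
  "kernel_chain X K 0 x y = (if x = y then 1 else 0)"
| "kernel_chain X K (Suc m) x y = (\<Sum>z\<in>X. kernel_chain X K m x z * K m z y)"

lemma kernel_chain_scale:
  "kernel_chain X (\<lambda>j x y. c j * K j x y) m x y = (\<Prod>j<m. c j) * kernel_chain X K m x y"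
  by (induction m arbitrary: y) (auto simp: sum_distrib_left ac_simps intro!: sum.cong)

text \<open>The mixed-product rule for Kronecker products: a sum over all functions of a product
  over coordinates is the product of the coordinatewise sums.\<close>

lemma kernel_chain_tensor:
  assumes "finite I" "finite V" "\<xi> \<in> I \<rightarrow>\<^sub>E V" "\<eta> \<in> I \<rightarrow>\<^sub>E V"
  shows "kernel_chain (I \<rightarrow>\<^sub>E V) (\<lambda>j \<xi> \<eta>. \<Prod>i\<in>I. K j (\<xi> i) (\<eta> i)) m \<xi> \<eta>
       = (\<Prod>i\<in>I. kernel_chain V K m (\<xi> i) (\<eta> i))"
  using assms(4)
proof (induction m arbitrary: \<eta>)
  case 0
  \<comment> \<open>Extensionality outside \<open>I\<close> makes the identity kernel on the
    function space a product of identity kernels.\<close>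
  have "\<xi> = \<eta> \<longleftrightarrow> (\<forall>i\<in>I. \<xi> i = \<eta> i)"
    using 0 assms(3) by (blast intro: PiE_ext)
  then show ?case using assms(1) by (auto intro!: prod_zero)
next
  case (Suc m)
  have "kernel_chain (I \<rightarrow>\<^sub>E V) (\<lambda>j \<xi> \<eta>. \<Prod>i\<in>I. K j (\<xi> i) (\<eta> i)) (Suc m) \<xi> \<eta>
     = (\<Sum>\<zeta>\<in>I \<rightarrow>\<^sub>E V. \<Prod>i\<in>I. kernel_chain V K m (\<xi> i) (\<zeta> i) * K m (\<zeta> i) (\<eta> i))"
    by (simp add: Suc.IH prod.distrib)
  also have "\<dots> = (\<Prod>i\<in>I. \<Sum>z\<in>V. kernel_chain V K m (\<xi> i) z * K m z (\<eta> i))"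
    using assms(1,2) by (subst prod_sum_PiE) auto
  finally show ?case by simp
qed

text \<open>All coordinates use the same kernels, so the trace of the tensor product is a pure
  power. This is where the exponent \<open>N\<close> of the limit argument comes from.\<close>

lemma kernel_chain_trace_tensor:
  assumes "finite I" "finite V"
  shows "(\<Sum>\<xi>\<in>I \<rightarrow>\<^sub>E V. kernel_chain (I \<rightarrow>\<^sub>E V) (\<lambda>j \<xi> \<eta>. \<Prod>i\<in>I. K j (\<xi> i) (\<eta> i)) m \<xi> \<xi>)
       = (\<Sum>x\<in>V. kernel_chain V K m x x) ^ card I"
proof -
  have "(\<Sum>\<xi>\<in>I \<rightarrow>\<^sub>E V. kernel_chain (I \<rightarrow>\<^sub>E V) (\<lambda>j \<xi> \<eta>. \<Prod>i\<in>I. K j (\<xi> i) (\<eta> i)) m \<xi> \<xi>)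
      = (\<Sum>\<xi>\<in>I \<rightarrow>\<^sub>E V. \<Prod>i\<in>I. kernel_chain V K m (\<xi> i) (\<xi> i))"
    by (intro sum.cong kernel_chain_tensor assms refl)
  also have "\<dots> = (\<Prod>i\<in>I. \<Sum>x\<in>V. kernel_chain V K m x x)"
    using assms by (subst prod_sum_PiE) auto
  finally show ?thesis by simp
qed

text \<open>Consecutive terms are arbitrary elements of \<open>X\<close>, not adjacent vertices; the
  kernels supply the weights. Extensionality on \<open>{..m}\<close> makes the set finite.\<close>

definition chains :: "'x set \<Rightarrow> nat \<Rightarrow> 'x \<Rightarrow> 'x \<Rightarrow> (nat \<Rightarrow> 'x) set" where
  "chains X m x y = {w \<in> {..m} \<rightarrow>\<^sub>E X. w 0 = x \<and> w m = y}"

lemma finite_chains: "finite X \<Longrightarrow> finite (chains X m x y)"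
  unfolding chains_def by (rule finite_subset[of _ "{..m} \<rightarrow>\<^sub>E X"]) (auto intro: finite_PiE)

text \<open>Expands the matrix product into paths, so that each summand is a product whose factor
  \<open>j\<close> involves \<open>K j\<close> alone. Integration over a product measure and the
  counting of monomials both start from this form.\<close>

lemma kernel_chain_eq_sum_chains:
  assumes "finite X" "x \<in> X" "y \<in> X"
  shows "kernel_chain X K m x y = (\<Sum>w\<in>chains X m x y. \<Prod>j<m. K j (w j) (w (Suc j)))"
  using assms(3)
proof (induction m arbitrary: y)
  case 0
  show ?case
  proof (cases "x = y")
    case True
    then have "chains X 0 x y = {\<lambda>i. if i = 0 then x else undefined}"
      using 0 by (auto simp: chains_def PiE_def extensional_def fun_eq_iff)
    then show ?thesis using True by simp
  next
    case False
    then have "chains X 0 x y = {}" by (auto simp: chains_def)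
    then show ?thesis using False by simp
  qed
next
  case (Suc m)
  have "kernel_chain X K (Suc m) x y
      = (\<Sum>z\<in>X. \<Sum>w\<in>chains X m x z. (\<Prod>j<m. K j (w j) (w (Suc j))) * K m z y)"
    by (simp add: Suc.IH sum_distrib_right)
  also have "\<dots> = (\<Sum>(z, w)\<in>Sigma X (chains X m x).
                     (\<Prod>j<m. K j (w j) (w (Suc j))) * K m z y)"
    using assms(1) by (simp add: sum.Sigma finite_chains)
  also have "\<dots> = (\<Sum>w\<in>chains X (Suc m) x y. \<Prod>j<Suc m. K j (w j) (w (Suc j)))"
  \<comment> \<open>A chain ending in z is extended by the new endpoint y. The inverse reads z off
    at position m and resets position \<open>Suc m\<close> to \<open>undefined\<close>, as
    extensionality demands.\<close>
  proof (rule sum.reindex_bij_witness[where i = "\<lambda>w. (w m, w(Suc m := undefined))"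
           and j = "\<lambda>(z, w). w(Suc m := y)"])
    fix a assume "a \<in> Sigma X (chains X m x)"
    then show "(\<lambda>w. (w m, w(Suc m := undefined))) ((\<lambda>(z, w). w(Suc m := y)) a) = a"
      by (auto simp: chains_def PiE_def extensional_def fun_eq_iff)
  next
    fix a assume "a \<in> Sigma X (chains X m x)"
    then show "(case a of (z, w) \<Rightarrow> w(Suc m := y)) \<in> chains X (Suc m) x y"
      using Suc.prems by (auto simp: chains_def PiE_def extensional_def Pi_def)
  next
    fix a assume a: "a \<in> Sigma X (chains X m x)"
    obtain z w where zw: "a = (z, w)" by force
    have "(\<Prod>j<m. K j ((w(Suc m := y)) j) ((w(Suc m := y)) (Suc j))) = (\<Prod>j<m. K j (w j) (w (Suc j)))"
      by (intro prod.cong) auto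
    then show "(\<Prod>j<Suc m. K j ((case a of (z, w) \<Rightarrow> w(Suc m := y)) j)
                     ((case a of (z, w) \<Rightarrow> w(Suc m := y)) (Suc j)))
            = (case a of (z, w) \<Rightarrow> (\<Prod>j<m. K j (w j) (w (Suc j))) * K m z y)"
      using a by (simp add: zw chains_def)
  qed (auto simp: chains_def PiE_def extensional_def Pi_def fun_eq_iff)
  finally show ?case .
qed

lemma kernel_chain_poly_eval:
  "poly (kernel_chain X K m x y) t = kernel_chain X (\<lambda>j x y. poly (K j x y) t) m x y"
  by (induction m arbitrary: y) (auto simp: poly_sum)

section \<open>Matrix powers and traces as iterated kernels\<close>

lemma pow_mat_eq_kernel_chain:
  assumes e: "bij_betw e {..<n} X" and "i < n" "j < n"
  shows "(mat n n (\<lambda>(i, j). K (e i) (e j)) ^\<^sub>m m) $$ (i, j) = kernel_chain X (\<lambda>_. K) m (e i) (e j)"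
  using assms(3)
proof (induction m arbitrary: j)
  case 0
  then show ?case using assms by (auto simp: bij_betw_def inj_on_def)
next
  case (Suc m)
  let ?A = "mat n n (\<lambda>(i, j). K (e i) (e j))"
  have d: "?A ^\<^sub>m m \<in> carrier_mat n n" by (intro pow_carrier_mat) auto
  have "(?A ^\<^sub>m Suc m) $$ (i, j) = (\<Sum>l\<in>{..<n}. (?A ^\<^sub>m m) $$ (i, l) * ?A $$ (l, j))"
    using d assms(2) Suc.prems by (auto simp: scalar_prod_def lessThan_atLeast0 intro!: sum.cong)
  also have "\<dots> = (\<Sum>l\<in>{..<n}. kernel_chain X (\<lambda>_. K) m (e i) (e l) * K (e l) (e j))"
    using Suc by (intro sum.cong) auto
  also have "\<dots> = (\<Sum>z\<in>X. kernel_chain X (\<lambda>_. K) m (e i) z * K z (e j))"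
    by (rule sum.reindex_bij_betw[OF e])
  finally show ?case by simp
qed

lemma mat_trace_pow_eq_kernel_chain:
  assumes e: "bij_betw e {..<n} X"
  shows "mat_trace (mat n n (\<lambda>(i, j). K (e i) (e j)) ^\<^sub>m m) = (\<Sum>x\<in>X. kernel_chain X (\<lambda>_. K) m x x)"
proof -
  have "mat_trace (mat n n (\<lambda>(i, j). K (e i) (e j)) ^\<^sub>m m)
      = (\<Sum>i<n. kernel_chain X (\<lambda>_. K) m (e i) (e i))"
    unfolding mat_trace_def
    by (intro sum.cong) (auto simp: pow_mat_eq_kernel_chain[OF e] pow_mat_dim)
  also have "\<dots> = (\<Sum>x\<in>X. kernel_chain X (\<lambda>_. K) m x x)"
    by (rule sum.reindex_bij_betw[OF e])
  finally show ?thesis .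
qed

text \<open>Along a fixed chain the factor of step j depends on \<open>\<theta> j\<close> only, and
  these coordinates are independent. Hence the mean of a product of random kernels is the product of
  the mean kernels.\<close>

lemma (in prob_space) kernel_chain_integral:
  fixes K :: "nat \<Rightarrow> 'a \<Rightarrow> 'x \<Rightarrow> 'x \<Rightarrow> 'b::{real_normed_field, banach, second_countable_topology}"
  assumes X: "finite X" "x \<in> X" "y \<in> X"
    and int: "\<And>j x y. integrable M (\<lambda>t. K j t x y)"
  shows "integrable (Pi\<^sub>M {..<m} (\<lambda>_. M)) (\<lambda>\<theta>. kernel_chain X (\<lambda>j. K j (\<theta> j)) m x y)" (is ?I)
    and "(\<integral>\<theta>. kernel_chain X (\<lambda>j. K j (\<theta> j)) m x y \<partial>Pi\<^sub>M {..<m} (\<lambda>_. M))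
       = kernel_chain X (\<lambda>j x y. \<integral>t. K j t x y \<partial>M) m x y" (is ?E)
proof -
  interpret product_sigma_finite "\<lambda>_::nat. M"
    by unfold_locales
  note I = product_integrable_prod[of "{..<m}" "\<lambda>j t. K j t (w j) (w (Suc j))" for w, OF _ int]
  note E = product_integral_prod[of "{..<m}" "\<lambda>j t. K j t (w j) (w (Suc j))" for w, OF _ int]
  show ?I unfolding kernel_chain_eq_sum_chains[OF X] by (intro Bochner_Integration.integrable_sum I) auto
  show ?E unfolding kernel_chain_eq_sum_chains[OF X]
    by (subst Bochner_Integration.integral_sum) (auto intro!: I sum.cong E)
qed

section \<open>Distances in Cartesian powers\<close>

definition adj_rel :: "'a ugraph \<Rightarrow> ('a \<times> 'a) set" where
  "adj_rel G = {(x, y). x \<in> verts G \<and> y \<in> verts G \<and> {x, y} \<in> edges G}"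

lemma adj_rel_sym: "(x, y) \<in> adj_rel G \<longleftrightarrow> (y, x) \<in> adj_rel G"
  by (auto simp: adj_rel_def insert_commute)

lemma relpow_adj_rel_sym: "(x, y) \<in> adj_rel G ^^ n \<longleftrightarrow> (y, x) \<in> adj_rel G ^^ n"
proof -
  have "(y, x) \<in> adj_rel G ^^ n" if "(x, y) \<in> adj_rel G ^^ n" for x y
    using that
  proof (induction n arbitrary: y)
    case (Suc n)
    then obtain z where "(x, z) \<in> adj_rel G ^^ n" "(z, y) \<in> adj_rel G" by (elim relpow_Suc_E)
    then show ?case using Suc.IH adj_rel_sym by (metis relpow_Suc_I2)
  qed simp
  then show ?thesis by blast
qed

lemma relpow_adj_rel_verts: "(x, y) \<in> adj_rel G ^^ n \<Longrightarrow> x \<in> verts G \<Longrightarrow> y \<in> verts G"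
  by (cases n) (auto elim!: relpow_Suc_E simp del: relpow.simps(2), simp_all add: adj_rel_def)

text \<open>Induction on the first step. A list of \<open>Suc n\<close> vertices makes n steps,
  which accounts for the shift.\<close>

lemma walks_length_iff:
  assumes "x \<in> verts G"
  shows "(\<exists>p\<in>walks G x y. length p = Suc n) \<longleftrightarrow> (x, y) \<in> adj_rel G ^^ n"
  using assms
proof (induction n arbitrary: x)
  case 0
  have "(\<exists>p\<in>walks G x y. length p = Suc 0) \<longleftrightarrow> x = y"
  proof
    assume "x = y"
    then have "[x] \<in> walks G x y" using 0 by (simp add: walks_def)
    then show "\<exists>p\<in>walks G x y. length p = Suc 0" by force
  qed (auto simp: walks_def length_Suc_conv)
  then show ?case by simp
next
  case (Suc n)
  have "(\<exists>p\<in>walks G x y. length p = Suc (Suc n))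
      \<longleftrightarrow> (\<exists>z. (x, z) \<in> adj_rel G \<and> (\<exists>p\<in>walks G z y. length p = Suc n))"
  proof
    assume "\<exists>p\<in>walks G x y. length p = Suc (Suc n)"
    then obtain p where p: "p \<in> walks G x y" "length p = Suc (Suc n)" by blast
    then obtain q where "p = x # q" "length q = Suc n"
      by (cases p) (auto simp: walks_def)
    moreover obtain z r where "q = z # r" using \<open>length q = Suc n\<close> by (cases q) auto
    ultimately have "(x, z) \<in> adj_rel G" "q \<in> walks G z y" "length q = Suc n"
      using p by (auto simp: walks_def adj_rel_def)
    then show "\<exists>z. (x, z) \<in> adj_rel G \<and> (\<exists>p\<in>walks G z y. length p = Suc n)" by blast
  next
    assume "\<exists>z. (x, z) \<in> adj_rel G \<and> (\<exists>p\<in>walks G z y. length p = Suc n)"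
    then obtain z q where q: "(x, z) \<in> adj_rel G" "q \<in> walks G z y" "length q = Suc n" by blast
    then have "x # q \<in> walks G x y"
      by (cases q) (auto simp: walks_def adj_rel_def)
    then show "\<exists>p\<in>walks G x y. length p = Suc (Suc n)" using q(3) by force
  qed
  also have "\<dots> \<longleftrightarrow> (\<exists>z. (x, z) \<in> adj_rel G \<and> (z, y) \<in> adj_rel G ^^ n)"
    using Suc.IH by (auto simp: adj_rel_def)
  also have "\<dots> \<longleftrightarrow> (x, y) \<in> adj_rel G ^^ Suc n"
    by (meson relpow_Suc_I2 relpow_Suc_D2)
  finally show ?case .
qed

text \<open>Natural-number values allow the distance to serve as an exponent and to be summed over
  coordinates. The value is meaningful only when some walk joins the two vertices.\<close>

definition nat_dist :: "'a ugraph \<Rightarrow> 'a \<Rightarrow> 'a \<Rightarrow> nat" where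
  "nat_dist G x y = (LEAST n. (x, y) \<in> adj_rel G ^^ n)"

lemma nat_dist_le: "(x, y) \<in> adj_rel G ^^ n \<Longrightarrow> nat_dist G x y \<le> n"
  unfolding nat_dist_def by (rule Least_le)

lemma nat_dist_commute: "nat_dist G x y = nat_dist G y x"
  unfolding nat_dist_def by (subst relpow_adj_rel_sym) simp

lemma nat_dist_eqI:
  assumes "(x, y) \<in> adj_rel G ^^ n" "\<And>m. (x, y) \<in> adj_rel G ^^ m \<Longrightarrow> n \<le> m"
  shows "nat_dist G x y = n"
  unfolding nat_dist_def using assms by (rule Least_equality)

lemma nat_dist_self: "nat_dist G x x = 0"
  using nat_dist_le[of x x 0 G] by simp

lemma graph_dist_eq_nat_dist:
  assumes "x \<in> verts G" "(x, y) \<in> adj_rel G ^^ n"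
  shows "graph_dist G x y = enat (nat_dist G x y)"
proof (rule antisym)
  have "(x, y) \<in> adj_rel G ^^ nat_dist G x y"
    unfolding nat_dist_def using assms(2) by (rule LeastI)
  then obtain p where "p \<in> walks G x y" "length p = Suc (nat_dist G x y)"
    using walks_length_iff[OF assms(1)] by blast
  then show "graph_dist G x y \<le> enat (nat_dist G x y)"
    unfolding graph_dist_def by (metis INF_lower diff_Suc_1)
  show "enat (nat_dist G x y) \<le> graph_dist G x y"
    unfolding graph_dist_def
  proof (rule INF_greatest)
    fix p assume p: "p \<in> walks G x y"
    then have "length p = Suc (length p - 1)" by (cases p) (auto simp: walks_def)
    then show "enat (nat_dist G x y) \<le> enat (length p - 1)"
      using walks_length_iff[OF assms(1)] p nat_dist_le by (metis enat_ord_simps(1))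
  qed
qed

section \<open>Distances in a finite connected graph and its powers\<close>

locale finite_connected_graph =
  fixes G :: "'a ugraph"
  assumes fin: "finite_simple_graph G" and conn: "connected_graph G"
begin

lemma finite_verts: "finite (verts G)"
  using fin by (simp add: finite_simple_graph_def)

lemma adj_rel_nat_dist:
  assumes "x \<in> verts G" "y \<in> verts G"
  shows "(x, y) \<in> adj_rel G ^^ nat_dist G x y"
proof -
  obtain p where p: "p \<in> walks G x y"
    using conn assms by (auto simp: connected_graph_def)
  then have "length p = Suc (length p - 1)" by (cases p) (auto simp: walks_def)
  then have "(x, y) \<in> adj_rel G ^^ (length p - 1)"
    using walks_length_iff[OF assms(1)] p by blast
  then show ?thesis unfolding nat_dist_def by (rule LeastI)
qed

lemma nat_dist_eq_0_iff:
  assumes "x \<in> verts G" "y \<in> verts G"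
  shows "nat_dist G x y = 0 \<longleftrightarrow> x = y"
  using adj_rel_nat_dist[OF assms] nat_dist_self by auto

lemma nat_dist_eq_1_iff:
  assumes "x \<in> verts G" "y \<in> verts G"
  shows "nat_dist G x y = 1 \<longleftrightarrow> {x, y} \<in> edges G"
proof
  assume "nat_dist G x y = 1"
  then show "{x, y} \<in> edges G"
    using adj_rel_nat_dist[OF assms] by (simp add: adj_rel_def)
next
  assume e: "{x, y} \<in> edges G"
  then have "x \<noteq> y" using fin by (auto simp: finite_simple_graph_def doubleton_eq_iff)
  moreover have "nat_dist G x y \<le> 1"
    using assms e by (intro nat_dist_le) (simp add: adj_rel_def)
  ultimately show "nat_dist G x y = 1"
    using nat_dist_eq_0_iff[OF assms] by linarith
qed

lemma nat_dist_step:
  assumes "(x, y) \<in> adj_rel G" "z \<in> verts G"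
  shows "nat_dist G x z \<le> Suc (nat_dist G y z)"
  using assms adj_rel_nat_dist[of y z]
  by (intro nat_dist_le relpow_Suc_I2[of x y]) (auto simp: adj_rel_def)

text \<open>The first step of a shortest walk lowers the distance by exactly one: the remaining walk
  gives one inequality, \<open>nat_dist_step\<close> the other.\<close>

lemma nat_dist_descent:
  assumes "x \<in> verts G" "y \<in> verts G" "x \<noteq> y"
  obtains z where "(x, z) \<in> adj_rel G" "nat_dist G x y = Suc (nat_dist G z y)"
proof -
  obtain n where n: "nat_dist G x y = Suc n"
    using nat_dist_eq_0_iff assms by (metis not0_implies_Suc)
  then obtain z where z: "(x, z) \<in> adj_rel G" "(z, y) \<in> adj_rel G ^^ n"
    using adj_rel_nat_dist[OF assms(1,2)] by (metis relpow_Suc_D2)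
  then have "nat_dist G z y \<le> n" by (intro nat_dist_le)
  moreover have "Suc n \<le> Suc (nat_dist G z y)"
    using nat_dist_step[OF z(1) assms(2)] n by simp
  ultimately show ?thesis using that z n by simp
qed

lemma adj_rel_cartesian_power:
  "(\<xi>, \<eta>) \<in> adj_rel (cartesian_power N G) \<longleftrightarrow>
     \<xi> \<in> {..<N} \<rightarrow>\<^sub>E verts G \<and> \<eta> \<in> {..<N} \<rightarrow>\<^sub>E verts G \<and>
     (\<exists>i<N. (\<xi> i, \<eta> i) \<in> adj_rel G \<and> (\<forall>j<N. j \<noteq> i \<longrightarrow> \<xi> j = \<eta> j))"
  (is "?L \<longleftrightarrow> ?R")
proof
  assume ?L
  then have V: "\<xi> \<in> {..<N} \<rightarrow>\<^sub>E verts G" "\<eta> \<in> {..<N} \<rightarrow>\<^sub>E verts G"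
    by (simp_all add: adj_rel_def cartesian_power_def)
  from \<open>?L\<close> obtain \<xi>' \<eta>' i where *: "{\<xi>, \<eta>} = {\<xi>', \<eta>'}"
    "i < N" "{\<xi>' i, \<eta>' i} \<in> edges G" "\<forall>j<N. j \<noteq> i \<longrightarrow> \<xi>' j = \<eta>' j"
    unfolding adj_rel_def cartesian_power_def by auto
  \<comment> \<open>An edge is an unordered pair, so its ends may appear in either order; the
    defining condition is symmetric in them.\<close>
  from *(1) have "\<xi> = \<xi>' \<and> \<eta> = \<eta>' \<or> \<xi> = \<eta>' \<and> \<eta> = \<xi>'" by (simp add: doubleton_eq_iff)
  then have "{\<xi> i, \<eta> i} \<in> edges G" "\<forall>j<N. j \<noteq> i \<longrightarrow> \<xi> j = \<eta> j"
    using *(3,4) by (metis insert_commute)+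
  moreover have "\<xi> i \<in> verts G" "\<eta> i \<in> verts G" using V *(2) by auto
  ultimately show ?R using V *(2) unfolding adj_rel_def by blast
next
  assume ?R
  then show ?L by (auto simp: adj_rel_def cartesian_power_def)
qed

text \<open>One step in the power moves a single coordinate along an edge, which lowers the sum of
  the coordinate distances by at most one.\<close>

lemma relpow_cartesian_power_ge:
  assumes "(\<xi>, \<eta>) \<in> adj_rel (cartesian_power N G) ^^ n" "\<xi> \<in> {..<N} \<rightarrow>\<^sub>E verts G"
  shows "(\<Sum>i<N. nat_dist G (\<xi> i) (\<eta> i)) \<le> n"
  using assms
proof (induction n arbitrary: \<xi>)
  case 0
  then show ?case by (simp add: nat_dist_self)
next
  case (Suc n)
  have "\<eta> \<in> verts (cartesian_power N G)"
    using relpow_adj_rel_verts[OF Suc.prems(1)] Suc.prems(2) by (simp add: cartesian_power_def)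
  then have \<eta>: "\<eta> i \<in> verts G" if "i < N" for i
    using that by (auto simp: cartesian_power_def)
  obtain \<zeta> where \<zeta>: "(\<xi>, \<zeta>) \<in> adj_rel (cartesian_power N G)"
    "(\<zeta>, \<eta>) \<in> adj_rel (cartesian_power N G) ^^ n"
    using Suc.prems(1) by (metis relpow_Suc_D2)
  then obtain i where i: "i < N" "(\<xi> i, \<zeta> i) \<in> adj_rel G" "\<forall>j<N. j \<noteq> i \<longrightarrow> \<xi> j = \<zeta> j"
    and "\<zeta> \<in> {..<N} \<rightarrow>\<^sub>E verts G"
    unfolding adj_rel_cartesian_power by blast
  then have IH: "(\<Sum>i<N. nat_dist G (\<zeta> i) (\<eta> i)) \<le> n" using Suc.IH \<zeta>(2) by blast
  have "(\<Sum>j<N. nat_dist G (\<xi> j) (\<eta> j)) \<le> (\<Sum>j<N. nat_dist G (\<zeta> j) (\<eta> j) + (if j = i then 1 else 0))"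
    using i \<eta> nat_dist_step[OF i(2) \<eta>[OF i(1)]] by (intro sum_mono) auto
  also have "\<dots> = (\<Sum>j<N. nat_dist G (\<zeta> j) (\<eta> j)) + 1"
    using i(1) by (simp add: sum.distrib)
  finally show ?case using IH by simp
qed

text \<open>A walk attaining the sum is built by descending in one coordinate at a time; each such
  step lowers the sum by exactly one.\<close>

lemma relpow_cartesian_power:
  assumes "\<xi> \<in> {..<N} \<rightarrow>\<^sub>E verts G" "\<eta> \<in> {..<N} \<rightarrow>\<^sub>E verts G"
  shows "(\<xi>, \<eta>) \<in> adj_rel (cartesian_power N G) ^^ (\<Sum>i<N. nat_dist G (\<xi> i) (\<eta> i))"
  using assms(1)
proof (induction "\<Sum>i<N. nat_dist G (\<xi> i) (\<eta> i)" arbitrary: \<xi>)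
  case 0
  then have "\<forall>i<N. nat_dist G (\<xi> i) (\<eta> i) = 0" by simp
  then have "\<forall>i<N. \<xi> i = \<eta> i"
    using nat_dist_eq_0_iff 0(2) assms(2) by (metis PiE_mem lessThan_iff)
  then have "\<xi> = \<eta>"
    using 0(2) assms(2) by (intro PiE_ext[of _ "{..<N}" "\<lambda>_. verts G"]) auto
  then show ?case by (simp add: nat_dist_self)
next
  case (Suc n)
  then obtain i where i: "i < N" "nat_dist G (\<xi> i) (\<eta> i) \<noteq> 0"
    by (metis (no_types, lifting) lessThan_iff nat.distinct(1) sum.neutral)
  have V: "\<xi> i \<in> verts G" "\<eta> i \<in> verts G" using i(1) Suc.prems assms(2) by auto
  moreover have "\<xi> i \<noteq> \<eta> i" using i(2) nat_dist_self by metis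
  ultimately obtain z where z: "(\<xi> i, z) \<in> adj_rel G" "nat_dist G (\<xi> i) (\<eta> i) = Suc (nat_dist G z (\<eta> i))"
    by (rule nat_dist_descent)
  \<comment> \<open>Coordinate i, which still differs from its target, moves one step along a
    shortest walk in \<open>G\<close>.\<close>
  define \<zeta> where "\<zeta> = \<xi>(i := z)"
  have \<zeta>: "\<zeta> \<in> {..<N} \<rightarrow>\<^sub>E verts G"
    using Suc.prems z i(1) by (auto simp: \<zeta>_def adj_rel_def PiE_def extensional_def Pi_def)
  have "(\<Sum>j<N. nat_dist G (\<xi> j) (\<eta> j)) = (\<Sum>j<N. nat_dist G (\<zeta> j) (\<eta> j) + (if j = i then 1 else 0))"
    using z by (intro sum.cong) (auto simp: \<zeta>_def)
  also have "\<dots> = (\<Sum>j<N. nat_dist G (\<zeta> j) (\<eta> j)) + 1"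
    using i(1) by (simp add: sum.distrib)
  finally have eq: "(\<Sum>j<N. nat_dist G (\<xi> j) (\<eta> j)) = Suc (\<Sum>j<N. nat_dist G (\<zeta> j) (\<eta> j))" by simp
  have "(\<xi>, \<zeta>) \<in> adj_rel (cartesian_power N G)"
    unfolding adj_rel_cartesian_power using Suc.prems \<zeta> z i(1)
    by (auto simp: \<zeta>_def intro!: exI[of _ i])
  moreover have "(\<zeta>, \<eta>) \<in> adj_rel (cartesian_power N G) ^^ (\<Sum>j<N. nat_dist G (\<zeta> j) (\<eta> j))"
    using Suc.hyps(1)[of \<zeta>] Suc.hyps(2) eq \<zeta> by simp
  ultimately show ?case unfolding eq by (rule relpow_Suc_I2)
qed

lemma graph_dist_cartesian_power:
  assumes "\<xi> \<in> {..<N} \<rightarrow>\<^sub>E verts G" "\<eta> \<in> {..<N} \<rightarrow>\<^sub>E verts G"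
  shows "graph_dist (cartesian_power N G) \<xi> \<eta> = enat (\<Sum>i<N. nat_dist G (\<xi> i) (\<eta> i))"
proof -
  have "nat_dist (cartesian_power N G) \<xi> \<eta> = (\<Sum>i<N. nat_dist G (\<xi> i) (\<eta> i))"
    using relpow_cartesian_power[OF assms] relpow_cartesian_power_ge assms(1) by (intro nat_dist_eqI)
  then show ?thesis
    using graph_dist_eq_nat_dist[OF _ relpow_cartesian_power[OF assms]] assms(1)
    by (simp add: cartesian_power_def)
qed

lemma edges_distance_cartesian_power_iff:
  assumes "\<xi> \<in> {..<N} \<rightarrow>\<^sub>E verts G" "\<eta> \<in> {..<N} \<rightarrow>\<^sub>E verts G"
  shows "{\<xi>, \<eta>} \<in> edges (distance_graph k (cartesian_power N G))
     \<longleftrightarrow> (\<Sum>i<N. nat_dist G (\<xi> i) (\<eta> i)) = k"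
proof -
  have "{\<xi>, \<eta>} \<in> edges (distance_graph k (cartesian_power N G)) \<longleftrightarrow>
     graph_dist (cartesian_power N G) \<xi> \<eta> = enat k \<or> graph_dist (cartesian_power N G) \<eta> \<xi> = enat k"
    using assms by (auto simp: distance_graph_def cartesian_power_def doubleton_eq_iff)
  then show ?thesis
    using assms by (simp add: graph_dist_cartesian_power nat_dist_commute)
qed

text \<open>The handshake identity: ordered adjacent pairs are grouped by their underlying edge, and
  each edge has two orientations because there are no loops.\<close>

lemma sum_adjacent:
  "(\<Sum>x\<in>verts G. \<Sum>y\<in>verts G. if nat_dist G x y = 1 then 1 else 0 :: real) = 2 * card (edges G)"
proof -
  have "(\<Sum>x\<in>verts G. \<Sum>y\<in>verts G. if nat_dist G x y = 1 then 1 else 0 :: real)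
      = (\<Sum>(x, y)\<in>verts G \<times> verts G. if {x, y} \<in> edges G then 1 else 0)"
    by (subst sum.cartesian_product[symmetric]) (simp add: nat_dist_eq_1_iff[unfolded One_nat_def])
  also have "\<dots> = real (card (adj_rel G))"
  proof -
    have "adj_rel G = {p \<in> verts G \<times> verts G. {fst p, snd p} \<in> edges G}" by (auto simp: adj_rel_def)
    then show ?thesis using finite_verts
      by (simp add: case_prod_unfold sum.If_cases Int_def)
  qed
  also have "card (adj_rel G) = card (\<Union>e\<in>edges G. {p \<in> adj_rel G. {fst p, snd p} = e})"
    by (rule arg_cong[where f = card]) (auto simp: adj_rel_def)
  also have "\<dots> = (\<Sum>e\<in>edges G. card {p \<in> adj_rel G. {fst p, snd p} = e})"
  proof (rule card_UN_disjoint)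
    have "adj_rel G \<subseteq> verts G \<times> verts G" by (auto simp: adj_rel_def)
    then have "finite (adj_rel G)" using finite_verts by (meson finite_SigmaI finite_subset)
    then show "\<forall>e\<in>edges G. finite {p \<in> adj_rel G. {fst p, snd p} = e}" by simp
    have "edges G \<subseteq> Pow (verts G)" using fin by (auto simp: finite_simple_graph_def)
    then show "finite (edges G)" using finite_verts by (meson finite_Pow_iff finite_subset)
  qed auto
  also have "\<dots> = (\<Sum>e\<in>edges G. 2)"
  proof (rule sum.cong)
    fix e assume e: "e \<in> edges G"
    then obtain x y where xy: "e = {x, y}" "x \<in> verts G" "y \<in> verts G" "x \<noteq> y"
      using fin by (auto simp: finite_simple_graph_def)
    then have "{p \<in> adj_rel G. {fst p, snd p} = e} = {(x, y), (y, x)}"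
      using e by (auto simp: adj_rel_def doubleton_eq_iff insert_commute)
    then show "card {p \<in> adj_rel G. {fst p, snd p} = e} = 2" using xy(4) by simp
  qed simp
  finally show ?thesis by simp
qed

end

section \<open>Moments of eigenvalue distributions\<close>

lemma mat_trace_commute:
  fixes A B :: "'a::comm_ring_1 mat"
  assumes "A \<in> carrier_mat n n" "B \<in> carrier_mat n n"
  shows "mat_trace (A * B) = mat_trace (B * A)"
proof -
  have "mat_trace (A * B) = (\<Sum>i<n. \<Sum>j<n. A $$ (i, j) * B $$ (j, i))"
    using assms by (auto simp: mat_trace_def scalar_prod_def lessThan_atLeast0 intro!: sum.cong)
  also have "\<dots> = (\<Sum>j<n. \<Sum>i<n. B $$ (j, i) * A $$ (i, j))"
    by (subst sum.swap) (simp add: mult.commute)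
  also have "\<dots> = mat_trace (B * A)"
    using assms by (auto simp: mat_trace_def scalar_prod_def lessThan_atLeast0 intro!: sum.cong)
  finally show ?thesis .
qed

lemma mat_trace_similar:
  fixes A B :: "'a::comm_ring_1 mat"
  assumes "similar_mat_wit A B P Q"
  shows "mat_trace A = mat_trace B"
proof -
  define n where "n = dim_row A"
  note * = similar_mat_witD[OF n_def assms]
  have "mat_trace A = mat_trace (P * (B * Q))" using * by simp
  also have "\<dots> = mat_trace (B * Q * P)" using * by (intro mat_trace_commute[of _ n]) auto
  also have "B * Q * P = B" using * by simp
  finally show ?thesis .
qed

text \<open>Both claims go through one induction, since the diagonal of a product is multiplicative
  only thanks to the zeros below it.\<close>

lemma upper_triangular_pow:
  fixes B :: "'a::comm_ring_1 mat"
  assumes B: "B \<in> carrier_mat n n" "upper_triangular B" and "i < n"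
  shows "j < i \<Longrightarrow> (B ^\<^sub>m m) $$ (i, j) = 0" and "(B ^\<^sub>m m) $$ (i, i) = B $$ (i, i) ^ m"
proof -
  have "(\<forall>i<n. \<forall>j<i. (B ^\<^sub>m m) $$ (i, j) = 0) \<and> (\<forall>i<n. (B ^\<^sub>m m) $$ (i, i) = B $$ (i, i) ^ m)"
  proof (induction m)
    case 0
    then show ?case using B by auto
  next
    case (Suc m)
    have D: "B ^\<^sub>m m \<in> carrier_mat n n" using B(1) by (rule pow_carrier_mat)
    have *: "(B ^\<^sub>m Suc m) $$ (i, j) = (\<Sum>l<n. (B ^\<^sub>m m) $$ (i, l) * B $$ (l, j))" if "i < n" "j < n" for i j
      using D B that by (auto simp: scalar_prod_def lessThan_atLeast0 intro!: sum.cong)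
    have z: "B $$ (l, j) = 0" if "j < l" "l < n" for l j
      using B that by auto
    show ?case
    proof (intro conjI allI impI)
      fix i j assume ij: "i < n" "j < i"
      \<comment> \<open>For l < i the first factor vanishes by induction; otherwise j < i \<le> l
        and the second factor lies below the diagonal of \<open>B\<close>.\<close>
      have "(B ^\<^sub>m m) $$ (i, l) * B $$ (l, j) = 0" if "l < n" for l
        using Suc z[of j l] ij that by (cases "l < i") auto
      then show "(B ^\<^sub>m Suc m) $$ (i, j) = 0"
        using ij by (subst *) (auto intro!: sum.neutral)
    next
      fix i assume i: "i < n"
      have "(\<Sum>l<n. (B ^\<^sub>m m) $$ (i, l) * B $$ (l, i)) = (\<Sum>l\<in>{i}. (B ^\<^sub>m m) $$ (i, l) * B $$ (l, i))"
      proof (rule sum.mono_neutral_right)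
        show "\<forall>l\<in>{..<n} - {i}. (B ^\<^sub>m m) $$ (i, l) * B $$ (l, i) = 0"
          using Suc z i by (metis Diff_iff insertI1 lessThan_iff linorder_neqE_nat mult_zero_left mult_zero_right)
      qed (use i in auto)
      then show "(B ^\<^sub>m Suc m) $$ (i, i) = B $$ (i, i) ^ Suc m"
        using Suc i by (subst *) auto
    qed
  qed
  then show "j < i \<Longrightarrow> (B ^\<^sub>m m) $$ (i, j) = 0" and "(B ^\<^sub>m m) $$ (i, i) = B $$ (i, i) ^ m"
    using assms by auto
qed

text \<open>Schur decomposition makes \<open>A\<close> similar to an upper triangular matrix with
  diagonal \<open>es\<close>. Similarity preserves the trace of powers, and triangular powers act
  entrywise on the diagonal.\<close>

lemma mat_trace_pow_eq_sum_list:
  fixes A :: "'a::conjugatable_ordered_field mat"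
  assumes A: "A \<in> carrier_mat n n" and cp: "char_poly A = (\<Prod>a\<leftarrow>es. [:- a, 1:])"
  shows "mat_trace (A ^\<^sub>m m) = (\<Sum>a\<leftarrow>es. a ^ m)"
proof -
  obtain B P Q where "schur_decomposition A es = (B, P, Q)"
    by (cases "schur_decomposition A es")
  from schur_decomposition[OF A cp this]
  have wit: "similar_mat_wit A B P Q" and ut: "upper_triangular B" and diag: "diag_mat B = es" by auto
  have B: "B \<in> carrier_mat n n" using similar_mat_witD2[OF A wit] by auto
  have "mat_trace (A ^\<^sub>m m) = mat_trace (B ^\<^sub>m m)"
    by (rule mat_trace_similar[OF similar_mat_wit_pow[OF wit]])
  also have "\<dots> = (\<Sum>i<n. B $$ (i, i) ^ m)"
    using B by (auto simp: mat_trace_def upper_triangular_pow(2)[OF B ut] pow_mat_dim intro!: sum.cong)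
  also have "\<dots> = (\<Sum>a\<leftarrow>es. a ^ m)"
    using B unfolding diag[symmetric] diag_mat_def
    by (simp add: sum_list_distinct_conv_sum_set lessThan_atLeast0 comp_def)
  finally show ?thesis .
qed

text \<open>The Hermitian form of a real symmetric matrix takes real values. At an eigenvector its
  value is the eigenvalue times the squared norm \<open>S\<close>, which is positive.\<close>

lemma real_symmetric_eigenvalue_real:
  fixes A :: "real mat"
  assumes A: "A \<in> carrier_mat n n" and sym: "\<And>i j. i < n \<Longrightarrow> j < n \<Longrightarrow> A $$ (i, j) = A $$ (j, i)"
    and ev: "eigenvalue (map_mat complex_of_real A) a"
  shows "a \<in> \<real>"
proof -
  obtain v where v: "v \<in> carrier_vec n" "v \<noteq> 0\<^sub>v n" "map_mat complex_of_real A *\<^sub>v v = a \<cdot>\<^sub>v v"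
    using ev A by (auto simp: eigenvalue_def eigenvector_def)
  have comp: "(\<Sum>j<n. A $$ (i, j) * v $ j) = a * v $ i" if "i < n" for i
  proof -
    have "(map_mat complex_of_real A *\<^sub>v v) $ i = (\<Sum>j<n. A $$ (i, j) * v $ j)"
      using A v(1) that by (auto simp: scalar_prod_def lessThan_atLeast0 intro!: sum.cong)
    then show ?thesis using v(1,3) that by simp
  qed
  define S where "S = (\<Sum>i<n. (cmod (v $ i))\<^sup>2)"
  have 1: "(\<Sum>i<n. \<Sum>j<n. A $$ (i, j) * v $ j * cnj (v $ i)) = a * of_real S"
  proof -
    have "(\<Sum>i<n. \<Sum>j<n. A $$ (i, j) * v $ j * cnj (v $ i)) = (\<Sum>i<n. a * (v $ i * cnj (v $ i)))"
      by (intro sum.cong) (auto simp: comp[symmetric] sum_distrib_right mult.assoc[symmetric])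
    then show ?thesis by (simp add: S_def sum_distrib_left complex_norm_square del: of_real_power)
  qed
  have "(\<Sum>i<n. \<Sum>j<n. A $$ (i, j) * v $ j * cnj (v $ i)) = (\<Sum>j<n. \<Sum>i<n. A $$ (i, j) * v $ j * cnj (v $ i))"
    by (rule sum.swap)
  \<comment> \<open>Swapping the summation indices and using symmetry of the real entries conjugates
    the form.\<close>
  also have "\<dots> = cnj (\<Sum>i<n. \<Sum>j<n. A $$ (i, j) * v $ j * cnj (v $ i))"
    by (auto simp: sym ac_simps intro!: sum.cong)
  finally have "a * of_real S = cnj a * of_real S" unfolding 1 by simp
  moreover have "S \<noteq> 0"
  proof -
    obtain i where "i < n" "v $ i \<noteq> 0" using v(1,2) by (metis carrier_vecD eq_vecI index_zero_vec)
    then have "S > 0" unfolding S_def by (intro sum_pos2[of _ i]) auto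
    then show ?thesis by simp
  qed
  ultimately show ?thesis by (simp add: Reals_cnj_iff)
qed

text \<open>The factorization exists over the complex numbers and all its roots are real; it
  descends because the embedding of real polynomials into complex ones is injective.\<close>

lemma real_symmetric_char_poly_splits:
  fixes A :: "real mat"
  assumes A: "A \<in> carrier_mat n n" and sym: "\<And>i j. i < n \<Longrightarrow> j < n \<Longrightarrow> A $$ (i, j) = A $$ (j, i)"
  obtains es where "char_poly A = (\<Prod>a\<leftarrow>es. [:- a, 1:])" "length es = n"
proof -
  let ?A = "map_mat complex_of_real A"
  interpret h: inj_comm_ring_hom complex_of_real by unfold_locales auto
  interpret hp: map_poly_inj_comm_ring_hom complex_of_real ..
  have A': "?A \<in> carrier_mat n n" using A by simp
  obtain as where as: "char_poly ?A = (\<Prod>a\<leftarrow>as. [:- a, 1:])" "length as = n"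
    using char_poly_factorized[OF A'] by blast
  have "a \<in> \<real>" if "a \<in> set as" for a
  proof (rule real_symmetric_eigenvalue_real[OF A sym])
    show "eigenvalue ?A a"
      unfolding eigenvalue_root_char_poly[OF A'] as(1) using that
      by (auto simp: poly_prod_list prod_list_zero_iff)
  qed auto
  then have re: "map (complex_of_real \<circ> Re) as = as"
    by (intro map_idI) auto
  define es where "es = map Re as"
  have "map_poly complex_of_real (\<Prod>a\<leftarrow>es. [:- a, 1:]) = (\<Prod>a\<leftarrow>map (complex_of_real \<circ> Re) as. [:- a, 1:])"
    by (simp add: es_def hp.hom_prod_list comp_def)
  also have "\<dots> = map_poly complex_of_real (char_poly A)"
    unfolding re as(1)[symmetric] by (rule of_real_hom.char_poly_hom[OF A])
  finally have "char_poly A = (\<Prod>a\<leftarrow>es. [:- a, 1:])" by simp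
  then show ?thesis using as(2) by (intro that[of es]) (simp_all add: es_def)
qed

lemma sum_count_eq_sum_list:
  fixes f :: "'a \<Rightarrow> real"
  assumes "set xs \<subseteq> X" "finite X"
  shows "(\<Sum>a\<in>X. real (count (mset xs) a) * f a) = (\<Sum>a\<leftarrow>xs. f a)"
  using assms(1)
proof (induction xs)
  case (Cons b xs)
  have "(\<Sum>a\<in>X. real (count (mset (b # xs)) a) * f a)
      = (\<Sum>a\<in>X. (if a = b then f a else 0) + real (count (mset xs) a) * f a)"
    by (intro sum.cong) (auto simp: algebra_simps)
  then show ?case using Cons assms(2) by (simp add: sum.distrib)
qed simp

text \<open>Links the measure to the trace: the roots of the characteristic polynomial form the
  multiset \<open>es\<close>, and each atom has its multiplicity over n as mass. Positivity of n
  makes the multiset nonempty, as \<open>pmf_of_multiset\<close> requires.\<close>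

lemma eigenvalue_distribution_moment:
  fixes A :: "real mat"
  assumes A: "A \<in> carrier_mat n n" and sym: "\<And>i j. i < n \<Longrightarrow> j < n \<Longrightarrow> A $$ (i, j) = A $$ (j, i)"
    and n: "n > 0"
  shows "integrable (measure_pmf (eigenvalue_distribution A)) (\<lambda>x. x ^ m)"
    and "measure_pmf.expectation (eigenvalue_distribution A) (\<lambda>x. x ^ m) = mat_trace (A ^\<^sub>m m) / n"
proof -
  obtain es where es: "char_poly A = (\<Prod>a\<leftarrow>es. [:- a, 1:])" "length es = n"
    using real_symmetric_char_poly_splits[OF A sym] by blast
  have pr: "proots (char_poly A) = mset es"
    unfolding es(1)
  proof (induction es)
    case (Cons a es)
    have "(\<Prod>a\<leftarrow>es. [:- a, 1:]) \<noteq> 0" by (auto simp: prod_list_zero_iff)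
    then have "proots ([:- a, 1:] * (\<Prod>a\<leftarrow>es. [:- a, 1:])) = {#a#} + mset es"
      using Cons.IH by (subst proots_mult) (auto simp only: proots_linear_factor minus_minus pCons_eq_0_iff one_neq_zero)
    then show ?case by simp
  qed simp
  have ne: "mset es \<noteq> {#}" using n es(2) by auto
  have ed: "eigenvalue_distribution A = pmf_of_multiset (mset es)"
    by (simp add: eigenvalue_distribution_def pr)
  have set: "set_pmf (eigenvalue_distribution A) = set es"
    unfolding ed using set_pmf_of_multiset[OF ne] by simp
  show "integrable (measure_pmf (eigenvalue_distribution A)) (\<lambda>x. x ^ m)"
    by (rule integrable_measure_pmf_finite) (simp add: set)
  have "measure_pmf.expectation (eigenvalue_distribution A) (\<lambda>x. x ^ m)
      = (\<Sum>a\<in>set es. pmf (eigenvalue_distribution A) a * a ^ m)"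
    by (subst integral_measure_pmf[of "set es"]) (auto simp: set)
  also have "\<dots> = (\<Sum>a\<in>set es. count (mset es) a * a ^ m) / n"
    using es(2) by (simp add: ed pmf_of_multiset[OF ne] sum_divide_distrib)
  also have "(\<Sum>a\<in>set es. count (mset es) a * a ^ m) = (\<Sum>a\<leftarrow>es. a ^ m)"
    by (rule sum_count_eq_sum_list) auto
  also have "\<dots> = mat_trace (A ^\<^sub>m m)"
    using mat_trace_pow_eq_sum_list[OF A es(1)] by simp
  finally show "measure_pmf.expectation (eigenvalue_distribution A) (\<lambda>x. x ^ m) = mat_trace (A ^\<^sub>m m) / n" .
qed

section \<open>Fourier coefficients on the circle and Gaussian exponentials\<close>

text \<open>The uniform distribution on the unit interval. It represents normalized arc length on
  the circle through the parametrization \<open>cis (2 * pi * t)\<close>.\<close>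

definition circle_measure :: "real measure" where
  "circle_measure = density lborel (\<lambda>t. ennreal (indicator {0..1} t))"

lemma sets_circle_measure [measurable_cong, simp]: "sets circle_measure = sets borel"
  by (simp add: circle_measure_def)

lemma prob_space_circle_measure: "prob_space circle_measure"
  by (rule prob_spaceI) (simp add: circle_measure_def emeasure_density ennreal_indicator)

lemma integrable_circle_measure:
  fixes f :: "real \<Rightarrow> complex"
  assumes "continuous_on UNIV f"
  shows "integrable circle_measure f"
proof -
  have [measurable]: "f \<in> borel_measurable borel"
    using assms by (rule borel_measurable_continuous_onI)
  have "set_integrable lborel {0..1} f"
    by (rule borel_integrable_atLeastAtMost') (use assms continuous_on_subset in blast)
  then show ?thesis
    by (simp add: circle_measure_def integrable_density set_integrable_def del: ennreal_indicator)
qed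

lemma integral_circle_measure:
  fixes f :: "real \<Rightarrow> complex"
  assumes "continuous_on UNIV f"
  shows "integral\<^sup>L circle_measure f = integral {0..1} f"
proof -
  have [measurable]: "f \<in> borel_measurable borel"
    using assms by (rule borel_measurable_continuous_onI)
  have "set_integrable lborel {0..1} f"
    by (rule borel_integrable_atLeastAtMost') (use assms continuous_on_subset in blast)
  then show ?thesis
    by (simp add: circle_measure_def integral_density set_borel_integral_eq_integral(2)[symmetric]
        set_lebesgue_integral_def del: ennreal_indicator)
qed

lemma continuous_on_circle:
  fixes f :: "complex \<Rightarrow> complex"
  assumes "continuous_on UNIV f"
  shows "continuous_on UNIV (\<lambda>t. f (cis (2 * pi * t)) / cis (2 * pi * t) ^ k)"
  by (intro continuous_intros continuous_on_compose2[OF assms]) auto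

text \<open>Cauchy's formula for the k-th derivative on the unit circle. The differential of the
  parametrization contributes one factor \<open>cis (2 * pi * t)\<close>, which reduces the exponent
  \<open>Suc k\<close> to k, and the constant \<open>2 * pi * \<i>\<close> cancels.\<close>

lemma circle_integral_taylor_coeff:
  assumes "f holomorphic_on UNIV"
  shows "(\<integral>t. f (cis (2 * pi * t)) / cis (2 * pi * t) ^ k \<partial>circle_measure)
       = (deriv ^^ k) f 0 / fact k"
proof -
  have c: "continuous_on UNIV f" using assms by (rule holomorphic_on_imp_continuous_on)
  have "((\<lambda>u. f u / (u - 0) ^ Suc k) has_contour_integral
          (2 * pi * \<i> / fact k * (deriv ^^ k) f 0)) (circlepath 0 1)"
    by (rule Cauchy_has_contour_integral_higher_derivative_circlepath)
       (use assms c continuous_on_subset holomorphic_on_subset in auto)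
  moreover have "circlepath 0 1 = (\<lambda>t. cis (2 * pi * t))"
    by (auto simp: circlepath cis_conv_exp fun_eq_iff ac_simps)
  moreover have "vector_derivative (circlepath 0 1) (at t within {0..1})
      = 2 * pi * \<i> * cis (2 * pi * t)" if "t \<in> {0..1}" for t :: real
    using that by (simp add: vector_derivative_circlepath01 cis_conv_exp ac_simps)
  ultimately have "((\<lambda>t. f (cis (2 * pi * t)) / cis (2 * pi * t) ^ Suc k *
      (2 * pi * \<i> * cis (2 * pi * t))) has_integral
        (2 * pi * \<i> / fact k * (deriv ^^ k) f 0)) {0..1}"
    unfolding has_contour_integral_def by (auto elim!: has_integral_eq[rotated])
  then have "((\<lambda>t. f (cis (2 * pi * t)) / cis (2 * pi * t) ^ Suc k *
      (2 * pi * \<i> * cis (2 * pi * t)) / (2 * pi * \<i>)) has_integral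
        (2 * pi * \<i> / fact k * (deriv ^^ k) f 0) / (2 * pi * \<i>)) {0..1}"
    by (rule has_integral_divide)
  then have "((\<lambda>t. f (cis (2 * pi * t)) / cis (2 * pi * t) ^ k) has_integral
        (deriv ^^ k) f 0 / fact k) {0..1}"
    by (simp add: field_simps)
  then show ?thesis
    using integral_circle_measure[OF continuous_on_circle[OF c]] by (auto simp: integral_unique)
qed

text \<open>Orthogonality of characters, read off from the Taylor coefficients of a power. It serves
  as the indicator that an exponent equals k.\<close>

lemma circle_integral_power:
  "(\<integral>t. cis (2 * pi * t) ^ n / cis (2 * pi * t) ^ k \<partial>circle_measure) = (if n = k then 1 else 0)"
proof -
  have "(\<lambda>z. z ^ n) has_fps_expansion (fps_X ^ n :: complex fps)"
    by (rule has_fps_expansion_fps_X_power)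
  from fps_nth_fps_expansion[OF this, of k, symmetric]
  have "(deriv ^^ k) (\<lambda>z::complex. z ^ n) 0 / fact k = (if k = n then 1 else 0)"
    unfolding fps_X_power_nth .
  moreover have "(\<lambda>z::complex. z ^ n) holomorphic_on UNIV" by (intro holomorphic_intros)
  ultimately show ?thesis using circle_integral_taylor_coeff[of "\<lambda>z. z ^ n" k] by (metis (full_types))
qed

text \<open>The exponential generating function of the Hermite polynomials with z rescaled by a. It
  solves a first-order linear differential equation, and comparing power series coefficients yields
  the Hermite recursion.\<close>

lemma hermite_generating_coeff:
  fixes a x :: real
  shows "(deriv ^^ n) (\<lambda>z::complex. exp (a * x * z - a\<^sup>2 * z\<^sup>2 / 2)) 0 / fact n
       = of_real (a ^ n * poly (hermite n) x / fact n)"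
proof -
  define h where "h = (\<lambda>z::complex. exp (a * x * z - a\<^sup>2 * z\<^sup>2 / 2))"
  define F where "F = fps_expansion h 0"
  have hol: "h holomorphic_on UNIV"
    unfolding h_def by (intro holomorphic_intros) auto
  have F: "h has_fps_expansion F"
    unfolding F_def using hol by (intro has_fps_expansion_fps_expansion[of UNIV]) auto
  have d: "deriv h z = (of_real (a * x) - of_real (a\<^sup>2) * z) * h z" for z
    unfolding h_def by (rule DERIV_imp_deriv) (auto intro!: derivative_eq_intros simp: field_simps)
  have "deriv h has_fps_expansion fps_deriv F"
    by (rule has_fps_expansion_deriv[OF F])
  moreover have "deriv h has_fps_expansion
      (fps_const (of_real (a * x)) - fps_const (of_real (a\<^sup>2)) * fps_X) * F"
    unfolding d[abs_def] by (intro fps_expansion_intros F)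
  ultimately have eq: "fps_deriv F = (fps_const (of_real (a * x)) - fps_const (of_real (a\<^sup>2)) * fps_X) * F"
    by (rule fps_expansion_unique_complex)
  then have eq: "fps_deriv F = fps_const (of_real (a * x)) * F - fps_const (of_real (a\<^sup>2)) * (fps_X * F)"
    by (simp only: left_diff_distrib mult.assoc)
  have rec1: "fps_nth F (Suc 0) = a * x * fps_nth F 0"
    using arg_cong[OF eq, of "\<lambda>G. fps_nth G 0"] by (simp add: algebra_simps)
  \<comment> \<open>After multiplication by n! and division by powers of a, this is the three-term
    recursion that defines \<open>hermite\<close>.\<close>
  have rec2: "of_nat (n + 2) * fps_nth F (Suc (Suc n)) = a * x * fps_nth F (Suc n) - a\<^sup>2 * fps_nth F n" for n
    using arg_cong[OF eq, of "\<lambda>G. fps_nth G (Suc n)"] by (simp only: fps_sub_nth fps_mult_left_const_nth fps_X_mult_nth fps_deriv_nth) simp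
  have "fps_nth F 0 = 1"
    using fps_nth_fps_expansion[OF F, of 0] by (simp add: h_def)
  then have "fps_nth F n = of_real (a ^ n * poly (hermite n) x / fact n)"
  proof (induction n rule: hermite.induct)
    case (3 n)
    have fct: "fact (Suc (Suc n)) = (real n + 2) * ((real n + 1) * fact n)"
      "fact (Suc n) = (real n + 1) * fact n"
      by (simp_all add: algebra_simps)
    have "a * x * (a ^ Suc n * poly (hermite (Suc n)) x / fact (Suc n)) - a\<^sup>2 * (a ^ n * poly (hermite n) x / fact n)
        = real (n + 2) * (a ^ Suc (Suc n) * poly (hermite (Suc (Suc n))) x / fact (Suc (Suc n)))"
    proof -
      have "real n + 1 \<noteq> 0" "real n + 2 \<noteq> 0" by linarith+
      then show ?thesis unfolding fct by (simp add: divide_simps) (simp add: power2_eq_square algebra_simps)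
    qed
    from arg_cong[OF this, of complex_of_real]
    have "of_nat (n + 2) * fps_nth F (Suc (Suc n))
        = of_nat (n + 2) * of_real (a ^ Suc (Suc n) * poly (hermite (Suc (Suc n))) x / fact (Suc (Suc n)))"
      unfolding rec2 3(1)[OF 3(3)] 3(2)[OF 3(3)]
      by (simp only: of_real_mult of_real_diff of_real_of_nat_eq)
    moreover have "of_nat (n + 2) \<noteq> (0 :: complex)" by (simp only: of_nat_eq_0_iff)
    ultimately show ?case by (simp only: mult_cancel_left simp_thms)
  qed (use rec1 in auto)
  then show ?thesis
    using fps_nth_fps_expansion[OF F, of n] by (simp add: h_def)
qed

text \<open>The moment generating function of the standard normal law at a complex argument.
  Translating by the real part u completes the square and leaves the characteristic function at the
  imaginary part v.\<close>

lemma
  fixes z :: complex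
  shows integrable_std_normal_exp: "integrable std_normal_distribution (\<lambda>x. exp (z * of_real x))"
    and integral_std_normal_exp: "(\<integral>x. exp (z * of_real x) \<partial>std_normal_distribution) = exp (z\<^sup>2 / 2)"
proof -
  define u v where "u = Re z" and "v = Im z"
  have z: "z = of_real u + \<i> * of_real v" by (simp add: u_def v_def complex_eq_iff)
  define P where "P = (\<lambda>x. std_normal_density x *\<^sub>R exp (z * of_real x))"
  \<comment> \<open>The form \<open>u + 1 * y\<close> matches the affine substitution rule for
    \<open>lborel\<close> with slope 1.\<close>
  have shift: "P (u + 1 * y) = exp (of_real (u\<^sup>2 / 2) + \<i> * v * u) * (std_normal_density y *\<^sub>R iexp (v * y))" for y
  proof -
    have "P (u + 1 * y) = of_real (1 / sqrt (2 * pi)) *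
        (exp (of_real (- (u + y)\<^sup>2 / 2)) * exp (z * of_real (u + y)))"
      by (simp add: P_def std_normal_density_def scaleR_conv_of_real exp_of_real[symmetric])
    also have "exp (of_real (- (u + y)\<^sup>2 / 2)) * exp (z * of_real (u + y))
        = exp (of_real (u\<^sup>2 / 2) + \<i> * v * u) * (exp (of_real (- y\<^sup>2 / 2)) * iexp (v * y))"
      unfolding exp_add[symmetric] z
      by (rule arg_cong[where f = exp]) (simp add: field_simps power2_eq_square)
    finally show ?thesis
      by (simp add: std_normal_density_def scaleR_conv_of_real exp_of_real[symmetric])
  qed
  have "integrable std_normal_distribution (\<lambda>y. iexp (v * y))"
  proof -
    interpret real_distribution std_normal_distribution by (rule real_dist_normal_dist)
    show ?thesis by (rule integrable_const_bound[where B = 1]) auto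
  qed
  then have I: "integrable lborel (\<lambda>y. std_normal_density y *\<^sub>R iexp (v * y))"
    by (subst (asm) integrable_density) (auto simp: normal_density_nonneg)
  then have "integrable lborel (\<lambda>y. P (u + 1 * y))"
    unfolding shift by (intro integrable_mult_right)
  then have "integrable lborel P"
    by (subst (asm) lborel_integrable_real_affine_iff) auto
  then show "integrable std_normal_distribution (\<lambda>x. exp (z * of_real x))"
    unfolding P_def by (subst integrable_density) (auto simp: normal_density_nonneg)
  have "(\<integral>x. exp (z * of_real x) \<partial>std_normal_distribution) = integral\<^sup>L lborel P"
    unfolding P_def by (subst integral_density) (auto simp: normal_density_nonneg)
  also have "\<dots> = (\<integral>y. P (u + 1 * y) \<partial>lborel)"
    by (subst lborel_integral_real_affine[where c = 1 and t = u]) auto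
  also have "\<dots> = exp (of_real (u\<^sup>2 / 2) + \<i> * v * u) * (\<integral>y. std_normal_density y *\<^sub>R iexp (v * y) \<partial>lborel)"
    unfolding shift by (intro Bochner_Integration.integral_mult_right I)
  also have "(\<integral>y. std_normal_density y *\<^sub>R iexp (v * y) \<partial>lborel) = char std_normal_distribution v"
    unfolding char_def by (subst integral_density) (auto simp: normal_density_nonneg)
  also have "exp (of_real (u\<^sup>2 / 2) + \<i> * v * u) * char std_normal_distribution v = exp (z\<^sup>2 / 2)"
    unfolding char_std_normal_distribution z exp_of_real[symmetric] exp_add[symmetric]
    by (rule arg_cong[where f = exp]) (simp add: field_simps power2_eq_square)
  finally show "(\<integral>x. exp (z * of_real x) \<partial>std_normal_distribution) = exp (z\<^sup>2 / 2)" .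
qed

section \<open>Second-order expansion\<close>

text \<open>The n-th powers of 1 + u and of exp u, with u = x n / n, differ by at most a constant
  times n times their distance. That distance is of second order in u, so the error is
  O(1/n).\<close>

lemma tendsto_one_plus_div_power:
  fixes x :: "nat \<Rightarrow> complex"
  assumes "x \<longlonglongrightarrow> l"
  shows "(\<lambda>n. (1 + x n / of_nat n) ^ n) \<longlonglongrightarrow> exp l"
proof -
  obtain K where K: "K > 0" "\<And>n. norm (x n) \<le> K"
    using convergent_imp_Bseq[of x] assms by (auto simp: convergent_def Bseq_def)
  have bound: "norm ((1 + x n / of_nat n) ^ n - exp (x n)) \<le> exp (2 * K) * K\<^sup>2 / n" if n: "n > 0" for n
  proof -
    define u where "u = x n / of_nat n"
    \<comment> \<open>Dividing by \<open>R\<close> puts both bases into the unit disc, where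
      \<open>norm_power_diff\<close> applies. Since \<open>R ^ n = exp K\<close>, undoing the
      division costs a factor independent of n.\<close>
    define R where "R = exp (K / n)"
    have u: "norm u \<le> K / n"
      using K(2)[of n] n by (simp add: u_def norm_divide divide_right_mono)
    have R: "R \<ge> 1" "R ^ n = exp K" "norm (exp u) \<le> R" "norm (1 + u) \<le> R"
    proof -
      show "R \<ge> 1" using K(1) by (simp add: R_def)
      show "R ^ n = exp K" using n by (simp add: R_def exp_of_nat_mult[symmetric])
      have "norm (exp u) \<le> exp (norm u)" by (rule norm_exp)
      then show "norm (exp u) \<le> R" using u unfolding R_def by (meson exp_le_cancel_iff order_trans)
      have "norm (1 + u) \<le> 1 + norm u" by (metis norm_one norm_triangle_ineq)
      also have "\<dots> \<le> exp (norm u)" by (rule exp_ge_add_one_self)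
      also have "\<dots> \<le> R" using u by (simp add: R_def)
      finally show "norm (1 + u) \<le> R" .
    qed
    have "norm (((1 + u) / of_real R) ^ n - (exp u / of_real R) ^ n)
        \<le> n * norm ((1 + u) / of_real R - exp u / of_real R)"
      using R by (intro norm_power_diff) (auto simp: norm_divide)
    then have "norm ((1 + u) ^ n - exp u ^ n) / R ^ n \<le> n * (norm (1 + u - exp u) / R)"
      using R(1) by (simp add: power_divide diff_divide_distrib[symmetric] norm_divide norm_power)
    also have "\<dots> \<le> n * norm (1 + u - exp u)"
      using R(1) mult_right_mono[OF R(1), of "norm (1 + u - exp u)"]
      by (intro mult_left_mono) (auto simp: field_simps)
    also have "norm (1 + u - exp u) \<le> exp \<bar>Re u\<bar> * norm u ^ 2"
      using Taylor_exp[of u 1] by (simp add: norm_minus_commute power2_eq_square)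
    also have "\<dots> \<le> exp K * (K / n) ^ 2"
    proof (intro mult_mono power_mono u)
      have "K / n \<le> K" using n K(1) by (simp add: field_simps)
      then show "exp \<bar>Re u\<bar> \<le> exp K" using u abs_Re_le_cmod[of u] by simp
    qed auto
    finally have "norm ((1 + u) ^ n - exp u ^ n) / exp K \<le> n * (exp K * (K / n) ^ 2)"
      unfolding R(2) by (simp add: mult_left_mono)
    then have "norm ((1 + u) ^ n - exp u ^ n) \<le> n * (exp K * (K / n) ^ 2) * exp K"
      by (simp add: pos_divide_le_eq)
    also have "\<dots> = exp (2 * K) * K\<^sup>2 / n"
      using n by (simp add: power2_eq_square exp_add[symmetric] field_simps mult_exp_exp)
    finally show ?thesis
      using n by (simp add: u_def exp_of_nat_mult[symmetric])
  qed
  have "(\<lambda>n. (1 + x n / of_nat n) ^ n - exp (x n)) \<longlonglongrightarrow> 0"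
  proof (rule Lim_null_comparison)
    show "\<forall>\<^sub>F n in sequentially. norm ((1 + x n / of_nat n) ^ n - exp (x n)) \<le> exp (2 * K) * K\<^sup>2 / n"
      using bound by (intro eventually_sequentiallyI[of 1]) auto
    show "(\<lambda>n. exp (2 * K) * K\<^sup>2 / real n) \<longlonglongrightarrow> 0"
      by (rule lim_const_over_n)
  qed
  from tendsto_add[OF this tendsto_exp[OF assms]] show ?thesis by simp
qed

text \<open>A bound uniform in n, needed for dominated convergence.\<close>

lemma norm_one_plus_div_power_le:
  fixes z :: complex
  assumes "norm z \<le> K"
  shows "norm ((1 + z / of_nat n) ^ n) \<le> exp K"
proof (cases "n = 0")
  case True
  then show ?thesis using assms norm_ge_zero[of z] by (simp del: norm_ge_zero)
next
  case False
  have "norm (1 + z / of_nat n) \<le> 1 + norm (z / of_nat n)" by (metis norm_one norm_triangle_ineq)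
  also have "\<dots> \<le> 1 + K / n" using assms by (simp add: norm_divide divide_right_mono)
  also have "\<dots> \<le> exp (K / n)" by (rule exp_ge_add_one_self)
  finally have "norm (1 + z / of_nat n) ^ n \<le> exp (K / n) ^ n" by (intro power_mono) auto
  then show ?thesis using False by (simp add: norm_power exp_of_nat_mult[symmetric])
qed

text \<open>The second elementary symmetric function of the first m values, grouped by the larger
  index so that it grows by one summand with m.\<close>

definition pair_sum :: "nat \<Rightarrow> (nat \<Rightarrow> 'a::comm_ring_1) \<Rightarrow> 'a" where
  "pair_sum m s = (\<Sum>j<m. (\<Sum>i<j. s i) * s j)"

lemma pair_sum_eq: "(\<Sum>j<m. s j)\<^sup>2 = (\<Sum>j<m. (s j)\<^sup>2) + 2 * pair_sum m s"
  by (induction m) (auto simp: pair_sum_def power2_eq_square algebra_simps)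

lemma norm_pair_sum_le:
  fixes s :: "nat \<Rightarrow> complex"
  assumes "\<And>j. norm (s j) \<le> 1"
  shows "norm (pair_sum m s) \<le> m * m"
proof -
  have "norm (pair_sum m s) \<le> (\<Sum>j<m. norm ((\<Sum>i<j. s i) * s j))"
    unfolding pair_sum_def by (rule norm_sum)
  also have "\<dots> \<le> (\<Sum>j<m. real m)"
  proof (rule sum_mono)
    fix j assume "j \<in> {..<m}"
    have "norm (\<Sum>i<j. s i) \<le> (\<Sum>i<j. 1)" by (rule sum_norm_le) (use assms in auto)
    then have "norm (\<Sum>i<j. s i) * norm (s j) \<le> real j * 1"
      using assms by (intro mult_mono) auto
    then show "norm ((\<Sum>i<j. s i) * s j) \<le> real m"
      using \<open>j \<in> {..<m}\<close> by (simp add: norm_mult)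
  qed
  finally show ?thesis by simp
qed

lemma prod_monom: "(\<Prod>j<m::nat. monom (c j) (r j)) = monom (\<Prod>j<m. c j) (\<Sum>j<m. r j)"
  by (induction m) (auto simp: mult_monom)

text \<open>Monomials of degree at most two are reproduced exactly, and each of the others has norm
  at most \<open>t ^ 3\<close> on the unit interval. The number of monomials thus bounds the error
  uniformly in the coefficients.\<close>

lemma poly_sum_monom_remainder:
  fixes c :: "'w \<Rightarrow> complex" and r :: "'w \<Rightarrow> nat" and t :: real
  assumes "finite W" "\<And>w. w \<in> W \<Longrightarrow> norm (c w) \<le> 1" "0 \<le> t" "t \<le> 1"
  defines "p \<equiv> (\<Sum>w\<in>W. monom (c w) (r w))"
  shows "norm (poly p t - (coeff p 0 + coeff p 1 * t + coeff p 2 * t\<^sup>2)) \<le> card W * t ^ 3"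
proof -
  \<comment> \<open>The value \<open>q n\<close> is \<open>t ^ n\<close> for n at most 2 and 0
    beyond.\<close>
  define q where "q n = (if n = 0 then 1 else 0) + (if n = 1 then t else 0) + (if n = 2 then t\<^sup>2 else 0)" for n :: nat
  have q: "\<bar>t ^ n - q n\<bar> \<le> t ^ 3" for n
  proof -
    consider "n = 0" | "n = 1" | "n = 2" | "n \<ge> 3" by linarith
    then show ?thesis
    proof cases
      case 4
      then show ?thesis using assms(3,4) by (simp add: q_def power_decreasing)
    qed (use assms(3) in \<open>auto simp: q_def\<close>)
  qed
  have "poly p t - (coeff p 0 + coeff p 1 * t + coeff p 2 * t\<^sup>2) = (\<Sum>w\<in>W. c w * of_real (t ^ r w - q (r w)))"
    unfolding p_def poly_sum coeff_sum sum_distrib_right sum.distrib[symmetric] sum_subtractf[symmetric]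
    by (intro sum.cong) (auto simp: poly_monom q_def algebra_simps)
  also have "norm \<dots> \<le> (\<Sum>w\<in>W. t ^ 3)"
  proof (rule sum_norm_le)
    fix w assume "w \<in> W"
    then have "norm (c w) * \<bar>t ^ r w - q (r w)\<bar> \<le> 1 * t ^ 3"
      using assms(2,3) q by (intro mult_mono) auto
    then show "norm (c w * of_real (t ^ r w - q (r w))) \<le> t ^ 3" by (simp only: norm_mult norm_of_real mult_1)
  qed
  finally show ?thesis by simp
qed

section \<open>Taylor coefficients of the distance chain\<close>

context finite_connected_graph
begin

text \<open>The degree of a chain's monomial is the total distance it travels. Degree 0 means
  staying put and degree 1 a single unit step. Degree 2 means either two unit steps at times i < j,
  whence \<open>pair_sum\<close>, or one step of length two, whence the sum of squares.\<close>

lemma coeff_dist_chain: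
  fixes s :: "nat \<Rightarrow> complex"
  assumes "x \<in> verts G" "y \<in> verts G"
  defines "P \<equiv> kernel_chain (verts G) (\<lambda>j x y. monom (s j ^ nat_dist G x y) (nat_dist G x y))"
  shows "coeff (P m x y) 0 = of_bool (x = y)"
    and "coeff (P m x y) 1 = (\<Sum>j<m. s j) * of_bool (nat_dist G x y = 1)"
    and "coeff (P m x y) 2 = pair_sum m s * (\<Sum>z\<in>verts G. of_bool (nat_dist G x z = 1) * of_bool (nat_dist G z y = 1))
           + (\<Sum>j<m. (s j)\<^sup>2) * of_bool (nat_dist G x y = 2)"
proof -
  let ?V = "verts G" and ?d = "nat_dist G"
  \<comment> \<open>Multiplication by the monomial of the last step shifts the degree by its length,
    so only last steps of length at most n contribute.\<close>
  have step: "coeff (P (Suc m) x y) n = (\<Sum>z\<in>?V. if ?d z y \<le> n then s m ^ ?d z y * coeff (P m x z) (n - ?d z y) else 0)" for m n y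
    unfolding P_def by (simp add: coeff_sum mult.commute[of _ "monom _ _"] coeff_monom_mult)
  have pick: "(\<Sum>z\<in>?V. of_bool (?d z y = 0) * g z) = g y" if "y \<in> ?V" for y and g :: "'a \<Rightarrow> complex"
  proof -
    have "(\<Sum>z\<in>?V. of_bool (?d z y = 0) * g z) = (\<Sum>z\<in>?V. if z = y then g z else 0)"
      using that by (intro sum.cong) (auto simp: nat_dist_eq_0_iff)
    then show ?thesis using that finite_verts by simp
  qed
  have pick': "(\<Sum>z\<in>?V. of_bool (x = z) * g z) = g x" for g :: "'a \<Rightarrow> complex"
    using assms(1) finite_verts by (simp add: of_bool_def if_distrib if_distribR cong: if_cong)
  have c0: "coeff (P m x y) 0 = of_bool (x = y)" if "y \<in> ?V" for m y
    using that
  proof (induction m arbitrary: y)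
    case (Suc m)
    have "coeff (P (Suc m) x y) 0 = (\<Sum>z\<in>?V. of_bool (?d z y = 0) * of_bool (x = z))"
      unfolding step using Suc.IH by (intro sum.cong) auto
    then show ?case using pick[OF Suc.prems] by simp
  qed (simp add: P_def)
  have c1: "coeff (P m x y) 1 = (\<Sum>j<m. s j) * of_bool (?d x y = 1)" if "y \<in> ?V" for m y
    using that
  proof (induction m arbitrary: y)
    case (Suc m)
    have "coeff (P (Suc m) x y) 1 = (\<Sum>z\<in>?V. of_bool (?d z y = 0) * coeff (P m x z) 1
        + of_bool (x = z) * (s m * of_bool (?d z y = 1)))"
      unfolding step
    proof (intro sum.cong refl)
      fix z assume z: "z \<in> ?V"
      consider "?d z y = 0" | "?d z y = 1" | "?d z y > 1" by linarith
      then show "(if ?d z y \<le> 1 then s m ^ ?d z y * coeff (P m x z) (1 - ?d z y) else 0)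
          = of_bool (?d z y = 0) * coeff (P m x z) 1 + of_bool (x = z) * (s m * of_bool (?d z y = 1))"
        by cases (auto simp: c0[OF z])
    qed
    also have "\<dots> = coeff (P m x y) 1 + s m * of_bool (?d x y = 1)"
      unfolding sum.distrib pick[OF Suc.prems] pick' ..
    finally show ?case using Suc by (simp add: algebra_simps)
  qed (simp add: P_def)
  have c2: "coeff (P m x y) 2 = pair_sum m s * (\<Sum>z\<in>?V. of_bool (?d x z = 1) * of_bool (?d z y = 1))
           + (\<Sum>j<m. (s j)\<^sup>2) * of_bool (?d x y = 2)" if "y \<in> ?V" for m y
    using that
  proof (induction m arbitrary: y)
    case (Suc m)
    \<comment> \<open>The three summands correspond to a last step of length 0, 1 or 2.\<close>
    have "coeff (P (Suc m) x y) 2 = (\<Sum>z\<in>?V. of_bool (?d z y = 0) * coeff (P m x z) 2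
        + (\<Sum>j<m. s j) * s m * (of_bool (?d x z = 1) * of_bool (?d z y = 1))
        + of_bool (x = z) * ((s m)\<^sup>2 * of_bool (?d z y = 2)))"
      unfolding step
    proof (intro sum.cong refl)
      fix z assume z: "z \<in> ?V"
      consider "?d z y = 0" | "?d z y = 1" | "?d z y = 2" | "?d z y > 2" by linarith
      then show "(if ?d z y \<le> 2 then s m ^ ?d z y * coeff (P m x z) (2 - ?d z y) else 0)
          = of_bool (?d z y = 0) * coeff (P m x z) 2
            + (\<Sum>j<m. s j) * s m * (of_bool (?d x z = 1) * of_bool (?d z y = 1))
            + of_bool (x = z) * ((s m)\<^sup>2 * of_bool (?d z y = 2))"
        by cases (use c0[OF z] c1[OF z] in \<open>auto simp: mult.commute\<close>)
    qed
    also have "\<dots> = coeff (P m x y) 2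
        + (\<Sum>j<m. s j) * s m * (\<Sum>z\<in>?V. of_bool (?d x z = 1) * of_bool (?d z y = 1))
        + (s m)\<^sup>2 * of_bool (?d x y = 2)"
      unfolding sum.distrib pick[OF Suc.prems] pick' sum_distrib_left[symmetric] ..
    finally show ?case using Suc by (simp add: pair_sum_def algebra_simps)
  qed (simp add: P_def pair_sum_def)
  show "coeff (P m x y) 0 = of_bool (x = y)"
    and "coeff (P m x y) 1 = (\<Sum>j<m. s j) * of_bool (nat_dist G x y = 1)"
    and "coeff (P m x y) 2 = pair_sum m s * (\<Sum>z\<in>verts G. of_bool (nat_dist G x z = 1) * of_bool (nat_dist G z y = 1))
           + (\<Sum>j<m. (s j)\<^sup>2) * of_bool (nat_dist G x y = 2)"
    using c0 c1 c2 assms(2) by auto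
qed

text \<open>On the diagonal the linear term and the single step of length two vanish, because the
  endpoints coincide. What remains at second order is to leave x for a neighbour and return, and
  such excursions number twice the edges.\<close>

lemma dist_chain_trace_expansion:
  fixes s :: "nat \<Rightarrow> complex" and t :: real
  assumes s: "\<And>j. norm (s j) \<le> 1" and t: "0 \<le> t" "t \<le> 1"
  shows "norm ((\<Sum>x\<in>verts G. kernel_chain (verts G) (\<lambda>j x y. (t * s j) ^ nat_dist G x y) m x x)
      - (card (verts G) + 2 * card (edges G) * pair_sum m s * t\<^sup>2))
    \<le> (\<Sum>x\<in>verts G. card (chains (verts G) m x x)) * t ^ 3"
proof -
  let ?V = "verts G" and ?d = "nat_dist G"
  define P where "P = kernel_chain ?V (\<lambda>j x y. monom (s j ^ ?d x y) (?d x y))"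
  have eval: "kernel_chain ?V (\<lambda>j x y. (t * s j) ^ ?d x y) m x x = poly (P m x x) t" for x
    unfolding P_def kernel_chain_poly_eval poly_monom by (simp add: power_mult_distrib mult.commute)
  have rem: "norm (poly (P m x x) t - (coeff (P m x x) 0 + coeff (P m x x) 1 * t + coeff (P m x x) 2 * t\<^sup>2))
      \<le> card (chains ?V m x x) * t ^ 3" if x: "x \<in> ?V" for x
    unfolding P_def kernel_chain_eq_sum_chains[OF finite_verts x x] prod_monom
    using finite_chains[OF finite_verts] t s
    by (intro poly_sum_monom_remainder)
       (auto simp: prod_norm[symmetric] norm_power intro!: prod_le_1 power_le_one)
  have "(\<Sum>x\<in>?V. coeff (P m x x) 2) = pair_sum m s * (\<Sum>x\<in>?V. \<Sum>z\<in>?V. of_real (if ?d x z = 1 then 1 else 0))"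
    unfolding P_def sum_distrib_left
    by (intro sum.cong refl, subst coeff_dist_chain(3))
       (auto simp: nat_dist_self nat_dist_commute sum_distrib_left intro!: sum.cong)
  also have "\<dots> = pair_sum m s * (2 * card (edges G))"
    unfolding of_real_sum[symmetric] sum_adjacent by simp
  finally have c2: "(\<Sum>x\<in>?V. coeff (P m x x) 2) = pair_sum m s * (2 * card (edges G))" .
  have "(\<Sum>x\<in>?V. coeff (P m x x) 0 + coeff (P m x x) 1 * t + coeff (P m x x) 2 * t\<^sup>2)
      = (\<Sum>x\<in>?V. 1) + (\<Sum>x\<in>?V. coeff (P m x x) 2) * t\<^sup>2"
    unfolding sum_distrib_right sum.distrib[symmetric] P_def
    by (intro sum.cong refl) (simp add: coeff_dist_chain(1) coeff_dist_chain(2)[unfolded One_nat_def] nat_dist_self)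
  also have "\<dots> = card ?V + 2 * card (edges G) * pair_sum m s * t\<^sup>2"
    unfolding c2 by simp
  finally have "norm ((\<Sum>x\<in>?V. kernel_chain ?V (\<lambda>j x y. (t * s j) ^ ?d x y) m x x)
      - (card ?V + 2 * card (edges G) * pair_sum m s * t\<^sup>2))
    = norm (\<Sum>x\<in>?V. poly (P m x x) t - (coeff (P m x x) 0 + coeff (P m x x) 1 * t + coeff (P m x x) 2 * t\<^sup>2))"
    unfolding eval sum_subtractf by simp
  also have "\<dots> \<le> (\<Sum>x\<in>?V. card (chains ?V m x x) * t ^ 3)"
    by (rule sum_norm_le) (rule rem)
  also have "\<dots> = (\<Sum>x\<in>?V. card (chains ?V m x x)) * t ^ 3"
    by (simp add: sum_distrib_right)
  finally show ?thesis .
qed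

end

section \<open>Passage to the limit\<close>

text \<open>The condition on k matters at x = 0, where \<open>0 powr 0\<close> is 0 but
  \<open>0 ^ 0\<close> is 1.\<close>

lemma sqrt_power_eq_powr:
  assumes "x \<ge> 0" "k \<ge> 1"
  shows "sqrt x ^ k = x powr (real k / 2)"
proof (cases "x = 0")
  case False
  then have "sqrt x ^ k = sqrt x powr real k" using assms by (simp add: powr_realpow)
  also have "\<dots> = x powr (real k / 2)" using assms by (simp add: powr_half_sqrt[symmetric] powr_powr)
  finally show ?thesis .
qed (use assms in \<open>simp add: power_0_left\<close>)

lemma borel_measurable_exp_complex:
  fixes f :: "'b \<Rightarrow> complex"
  assumes "f \<in> borel_measurable M"
  shows "(\<lambda>x. exp (f x)) \<in> borel_measurable M"
  using assms by (rule borel_measurable_continuous_on[rotated]) (intro continuous_intros)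

lemma of_real_kernel_chain:
  "of_real (kernel_chain X K m x y) = kernel_chain X (\<lambda>j x y. of_real (K j x y)) m x y"
  by (induction m arbitrary: y) auto

lemma borel_measurable_kernel_chain:
  fixes K :: "nat \<Rightarrow> 'b \<Rightarrow> 'x \<Rightarrow> 'x \<Rightarrow> complex"
  assumes "\<And>j x y. j < m \<Longrightarrow> (\<lambda>\<theta>. K j \<theta> x y) \<in> borel_measurable M"
  shows "(\<lambda>\<theta>. kernel_chain X (\<lambda>j. K j \<theta>) m x y) \<in> borel_measurable M"
  using assms
proof (induction m arbitrary: y)
  case (Suc m)
  have "(\<lambda>\<theta>. kernel_chain X (\<lambda>j. K j \<theta>) m x z) \<in> borel_measurable M"
    "(\<lambda>\<theta>. K m \<theta> z y) \<in> borel_measurable M" for z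
    using Suc by auto
  then show ?case by simp
qed simp

section \<open>The torus and the exchange of Gaussian and Fourier averages\<close>

abbreviation circ :: "real \<Rightarrow> complex" where
  "circ t \<equiv> cis (2 * pi * t)"

abbreviation torus_measure :: "nat \<Rightarrow> (nat \<Rightarrow> real) measure" where
  "torus_measure m \<equiv> Pi\<^sub>M {..<m} (\<lambda>_. circle_measure)"

lemma prob_space_torus_measure: "prob_space (torus_measure m)"
  by (intro prob_space_PiM prob_space_circle_measure)

lemma measurable_circ_component [measurable (raw)]:
  assumes "j < m"
  shows "(\<lambda>\<theta>. circ (\<theta> j)) \<in> borel_measurable (torus_measure m)"
proof -
  have "(\<lambda>t. circ t) \<in> borel_measurable circle_measure"
    unfolding measurable_cong_sets[OF sets_circle_measure refl]
    by (intro borel_measurable_continuous_onI continuous_intros)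
  moreover have "(\<lambda>\<theta>. \<theta> j) \<in> measurable (torus_measure m) circle_measure"
    using assms by (intro measurable_component_singleton) simp
  ultimately show ?thesis by (rule measurable_compose[rotated])
qed

lemma measurable_pair_circ_component:
  assumes "j < m"
  shows "(\<lambda>p. circ (snd p j)) \<in> borel_measurable (std_normal_distribution \<Otimes>\<^sub>M torus_measure m)"
  using measurable_compose[OF measurable_snd measurable_circ_component[OF assms]] .

text \<open>Fubini for the product of the generating functions, each divided by the k-th power of
  its own circle variable. Integrating the torus first extracts m equal Hermite coefficients.
  Integrating the Gaussian first gives the exponential of \<open>pair_sum\<close>.\<close>

lemma
  fixes a :: real and k m :: nat
  shows integrable_hermite_power:
      "integrable std_normal_distribution (\<lambda>x. (a ^ k * poly (hermite k) x / fact k) ^ m)"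
    and torus_integral_exp_pair_sum:
      "(\<integral>\<theta>. (\<Prod>j<m. 1 / circ (\<theta> j) ^ k) * exp (of_real (a\<^sup>2) * pair_sum m (\<lambda>j. circ (\<theta> j))) \<partial>torus_measure m)
       = of_real (\<integral>x. (a ^ k * poly (hermite k) x / fact k) ^ m \<partial>std_normal_distribution)"
proof -
  let ?N = "std_normal_distribution" and ?T = "torus_measure m"
  define g where "g = (\<lambda>x t. exp (a * x * circ t - a\<^sup>2 * (circ t)\<^sup>2 / 2) / circ t ^ k)"
  define f where "f = (\<lambda>x \<theta>. \<Prod>j<m. g x (\<theta> j))"
  interpret N: prob_space ?N by (rule real_distribution.axioms(1)[OF real_dist_normal_dist])
  interpret C: prob_space circle_measure by (rule prob_space_circle_measure)
  interpret T: prob_space ?T by (rule prob_space_torus_measure)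
  interpret P: pair_sigma_finite ?N ?T ..
  interpret PC: product_sigma_finite "\<lambda>_::nat. circle_measure" ..
  have inner: "(\<integral>\<theta>. f x \<theta> \<partial>?T) = of_real ((a ^ k * poly (hermite k) x / fact k) ^ m)" for x
  proof -
    have hol: "(\<lambda>z. exp (a * x * z - a\<^sup>2 * z\<^sup>2 / 2)) holomorphic_on UNIV"
      by (intro holomorphic_intros) auto
    have "(\<integral>t. g x t \<partial>circle_measure) = of_real (a ^ k * poly (hermite k) x / fact k)"
      unfolding g_def circle_integral_taylor_coeff[OF hol] by (rule hermite_generating_coeff)
    moreover have "integrable circle_measure (g x)"
      unfolding g_def
      by (rule integrable_circle_measure[OF continuous_on_circle[OF holomorphic_on_imp_continuous_on[OF hol]]])
    ultimately show ?thesis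
      unfolding f_def by (subst PC.product_integral_prod) auto
  qed
  have meas: "(\<lambda>p. f (fst p) (snd p)) \<in> borel_measurable (?N \<Otimes>\<^sub>M ?T)"
    unfolding f_def g_def
    by (intro borel_measurable_prod borel_measurable_divide borel_measurable_power borel_measurable_exp_complex
        borel_measurable_diff borel_measurable_times measurable_pair_circ_component)
       (auto intro: borel_measurable_of_real)
  \<comment> \<open>A majorant independent of \<open>\<theta>\<close>; the two signs together
    replace the absolute value of x, so integrability follows from the real exponentials.\<close>
  define B where "B = (\<lambda>x. exp (m * a\<^sup>2) * (exp (m * \<bar>a\<bar> * x) + exp (- (m * \<bar>a\<bar>) * x)))"
  have norm_f: "norm (f x \<theta>) \<le> B x" for x \<theta>
  proof -
    have "norm (g x t) \<le> exp (\<bar>a\<bar> * \<bar>x\<bar> + a\<^sup>2)" for t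
    proof -
      have "norm (g x t) = norm (exp (a * x * circ t - a\<^sup>2 * (circ t)\<^sup>2 / 2))"
        by (simp add: g_def norm_divide norm_power)
      also have "\<dots> \<le> exp (norm (a * x * circ t - a\<^sup>2 * (circ t)\<^sup>2 / 2))" by (rule norm_exp)
      also have "norm (a * x * circ t - a\<^sup>2 * (circ t)\<^sup>2 / 2)
          \<le> norm (a * x * circ t) + norm (a\<^sup>2 * (circ t)\<^sup>2 / 2)" by (rule norm_triangle_ineq4)
      also have "\<dots> \<le> \<bar>a\<bar> * \<bar>x\<bar> + a\<^sup>2" by (simp add: norm_mult norm_divide norm_power)
      finally show ?thesis by simp
    qed
    then have "norm (f x \<theta>) \<le> (\<Prod>j<m. exp (\<bar>a\<bar> * \<bar>x\<bar> + a\<^sup>2))"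
      unfolding f_def prod_norm[symmetric] by (intro prod_mono) auto
    also have "\<dots> = exp (m * a\<^sup>2) * exp (m * \<bar>a\<bar> * \<bar>x\<bar>)"
      by (simp add: exp_of_nat_mult[symmetric] exp_add[symmetric] algebra_simps)
    also have "exp (m * \<bar>a\<bar> * \<bar>x\<bar>) \<le> exp (m * \<bar>a\<bar> * x) + exp (- (m * \<bar>a\<bar>) * x)"
      by (cases "x \<ge> 0") auto
    finally show ?thesis by (simp add: B_def)
  qed
  have int_exp: "integrable ?N (\<lambda>x. exp (b * x))" for b :: real
  proof -
    have "integrable ?N (\<lambda>x. Re (exp (of_real b * of_real x)))"
      by (intro integrable_Re integrable_std_normal_exp)
    then show ?thesis by (simp only: of_real_mult[symmetric] exp_of_real Re_complex_of_real)
  qed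
  have "integrable ?N B"
    unfolding B_def by (intro integrable_mult_right Bochner_Integration.integrable_add int_exp)
  then have "integrable (distr (?N \<Otimes>\<^sub>M ?T) ?N fst) B"
    by (simp add: T.distr_pair_fst)
  then have "integrable (?N \<Otimes>\<^sub>M ?T) (\<lambda>p. B (fst p))"
    by (subst (asm) integrable_distr_eq) (auto simp: B_def)
  then have int: "integrable (?N \<Otimes>\<^sub>M ?T) (\<lambda>p. f (fst p) (snd p))"
    using meas by (rule Bochner_Integration.integrable_bound)
       (auto intro!: AE_I2 order_trans[OF norm_f])
  then have int': "integrable (?N \<Otimes>\<^sub>M ?T) (case_prod f)"
    by (simp add: case_prod_unfold)
  \<comment> \<open>Fubini also supplies the integrability of the Hermite power, as that of the
    inner integral.\<close>
  have "integrable ?N (\<lambda>x. \<integral>\<theta>. f x \<theta> \<partial>?T)"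
    using P.integrable_fst[OF int'] .
  then have "integrable ?N (\<lambda>x. Re (of_real ((a ^ k * poly (hermite k) x / fact k) ^ m)))"
    unfolding inner by (rule integrable_Re)
  then show "integrable ?N (\<lambda>x. (a ^ k * poly (hermite k) x / fact k) ^ m)"
    by (simp only: Re_complex_of_real)
  have outer: "(\<integral>x. f x \<theta> \<partial>?N) = (\<Prod>j<m. 1 / circ (\<theta> j) ^ k) * exp (of_real (a\<^sup>2) * pair_sum m (\<lambda>j. circ (\<theta> j)))" for \<theta>
  proof -
    let ?s = "\<lambda>j. circ (\<theta> j)"
    define z where "z = a * (\<Sum>j<m. ?s j)"
    define w where "w = a\<^sup>2 * (\<Sum>j<m. (?s j)\<^sup>2) / 2"
    have "f x \<theta> = (\<Prod>j<m. 1 / ?s j ^ k) * exp (- w) * exp (z * of_real x)" for x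
    proof -
      have "f x \<theta> = (\<Prod>j<m. 1 / ?s j ^ k) * (\<Prod>j<m. exp (a * x * ?s j - a\<^sup>2 * (?s j)\<^sup>2 / 2))"
        unfolding f_def g_def prod.distrib[symmetric] by simp
      also have "(\<Prod>j<m. exp (a * x * ?s j - a\<^sup>2 * (?s j)\<^sup>2 / 2)) = exp (- w + z * of_real x)"
        unfolding exp_sum[symmetric, OF finite_lessThan] z_def w_def
        by (rule arg_cong[where f = exp])
           (simp add: sum_subtractf sum_distrib_left sum_distrib_right sum_divide_distrib mult_ac)
      finally show ?thesis by (simp only: exp_add mult.assoc)
    qed
    then have "(\<integral>x. f x \<theta> \<partial>?N) = (\<Prod>j<m. 1 / ?s j ^ k) * exp (- w) * exp (z\<^sup>2 / 2)"
      by (simp add: integral_std_normal_exp)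
    also have "\<dots> = (\<Prod>j<m. 1 / ?s j ^ k) * exp (- w + z\<^sup>2 / 2)"
      by (simp only: exp_add mult.assoc)
    \<comment> \<open>The Gaussian average squares the sum of the circle variables, and w removes
      exactly the diagonal terms.\<close>
    also have "- w + z\<^sup>2 / 2 = of_real (a\<^sup>2) * pair_sum m ?s"
      unfolding z_def w_def power_mult_distrib pair_sum_eq by (simp add: field_simps)
    finally show ?thesis .
  qed
  have "(\<integral>\<theta>. (\<integral>x. f x \<theta> \<partial>?N) \<partial>?T) = (\<integral>x. (\<integral>\<theta>. f x \<theta> \<partial>?T) \<partial>?N)"
    by (rule P.Fubini_integral[OF int'])
  then show "(\<integral>\<theta>. (\<Prod>j<m. 1 / circ (\<theta> j) ^ k) * exp (of_real (a\<^sup>2) * pair_sum m (\<lambda>j. circ (\<theta> j))) \<partial>?T)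
      = of_real (\<integral>x. (a ^ k * poly (hermite k) x / fact k) ^ m \<partial>?N)"
    unfolding outer inner by (simp only: integral_complex_of_real)
qed

section \<open>The trace of the scaled distance matrix and its limit\<close>

context finite_connected_graph
begin

definition mean_degree :: real where
  "mean_degree = 2 * real (card (edges G)) / real (card (verts G))"

lemma mean_degree_nonneg: "mean_degree \<ge> 0"
  by (simp add: mean_degree_def)

lemma limit_function_eq:
  assumes "k \<ge> 1"
  shows "limit_function G k x = sqrt mean_degree ^ k * poly (hermite k) x / fact k"
  unfolding limit_function_def mean_degree_def[symmetric]
    sqrt_power_eq_powr[OF mean_degree_nonneg assms] by simp

abbreviation scale :: "nat \<Rightarrow> real" where
  "scale N \<equiv> 1 / sqrt (real N)"

definition chain_trace :: "nat \<Rightarrow> real \<Rightarrow> (nat \<Rightarrow> complex) \<Rightarrow> complex" where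
  "chain_trace m t s = (\<Sum>x\<in>verts G. kernel_chain (verts G) (\<lambda>j x y. (t * s j) ^ nat_dist G x y) m x x)"

text \<open>The entries of the scaled distance matrix indexed by vertices instead of positions; for
  positive N the factor \<open>scale N ^ k\<close> is \<open>N powr (- k / 2)\<close>.\<close>

definition distance_kernel :: "nat \<Rightarrow> nat \<Rightarrow> (nat \<Rightarrow> 'a) \<Rightarrow> (nat \<Rightarrow> 'a) \<Rightarrow> real" where
  "distance_kernel k N \<xi> \<eta> = (if (\<Sum>i<N. nat_dist G (\<xi> i) (\<eta> i)) = k then scale N ^ k else 0)"

lemma bij_betw_enum:
  fixes N :: nat
  shows
  "bij_betw (from_nat_into ({..<N} \<rightarrow>\<^sub>E verts G)) {..<card ({..<N} \<rightarrow>\<^sub>E verts G)} ({..<N} \<rightarrow>\<^sub>E verts G)"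
  by (intro bij_betw_from_nat_into_finite finite_PiE) (simp_all add: finite_verts)

lemma scaled_distance_matrix_eq:
  fixes N :: nat
  assumes "k \<ge> 1"
  defines "X \<equiv> {..<N} \<rightarrow>\<^sub>E verts G"
  shows "scaled_distance_matrix G k N = mat (card X) (card X)
    (\<lambda>(i, j). distance_kernel k N (from_nat_into X i) (from_nat_into X j))"
proof -
  have V: "verts (distance_graph k (cartesian_power N G)) = X"
    by (simp add: distance_graph_def cartesian_power_def X_def)
  have "from_nat_into X i \<in> X" if "i < card X" for i
    using bij_betw_enum[of N] that unfolding X_def bij_betw_def by blast
  then show ?thesis
    unfolding scaled_distance_matrix_def adjacency_matrix_def V
    using sqrt_power_eq_powr[of "real N" k] assms(1)
    by (intro eq_matI) (auto simp: distance_kernel_def edges_distance_cartesian_power_iff X_def power_one_over)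
qed

text \<open>Each of the m matrix factors is written as a circle average with its own variable.
  Independence moves all averages outside the trace, and the integrand, being multiplicative over
  coordinates, becomes an N-th power.\<close>

lemma mat_trace_scaled_distance_matrix:
  assumes "k \<ge> 1"
  shows "complex_of_real (mat_trace (scaled_distance_matrix G k N ^\<^sub>m m))
    = (\<integral>\<theta>. (\<Prod>j<m. 1 / circ (\<theta> j) ^ k) * chain_trace m (scale N) (\<lambda>j. circ (\<theta> j)) ^ N \<partial>torus_measure m)"
proof -
  let ?X = "{..<N} \<rightarrow>\<^sub>E verts G" and ?d = "nat_dist G"
  interpret C: prob_space circle_measure by (rule prob_space_circle_measure)
  \<comment> \<open>Both \<open>scale N\<close> and \<open>circ t\<close> are raised to the total
    distance. Averaging over t keeps only total distance k, where the first power is the required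
    constant; before averaging, \<open>L\<close> still factors over the coordinates.\<close>
  define L where "L = (\<lambda>(t::real) \<xi> \<eta>. 1 / circ t ^ k * (\<Prod>i<N. (scale N * circ t) ^ ?d (\<xi> i) (\<eta> i)))"
  have finX: "finite ?X" using finite_verts by (intro finite_PiE) auto
  have L: "L t \<xi> \<eta> = scale N ^ (\<Sum>i<N. ?d (\<xi> i) (\<eta> i)) * (circ t ^ (\<Sum>i<N. ?d (\<xi> i) (\<eta> i)) / circ t ^ k)" for t \<xi> \<eta>
    unfolding L_def power_sum[symmetric] by (simp add: power_mult_distrib power_divide)
  have pow: "integrable circle_measure (\<lambda>t. circ t ^ n / circ t ^ k)" for n
    by (intro integrable_circle_measure continuous_on_circle[of "\<lambda>z. z ^ n"] continuous_intros)
  have int: "integrable circle_measure (\<lambda>t. L t \<xi> \<eta>)" for \<xi> \<eta>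
    unfolding L by (intro integrable_mult_right pow)
  have E: "of_real (distance_kernel k N \<xi> \<eta>) = (\<integral>t. L t \<xi> \<eta> \<partial>circle_measure)" for \<xi> \<eta>
    unfolding L by (subst Bochner_Integration.integral_mult_right)
      (auto simp: circle_integral_power distance_kernel_def pow)
  have factor: "(\<Sum>\<xi>\<in>?X. kernel_chain ?X (\<lambda>j. L (\<theta> j)) m \<xi> \<xi>)
      = (\<Prod>j<m. 1 / circ (\<theta> j) ^ k) * chain_trace m (scale N) (\<lambda>j. circ (\<theta> j)) ^ N" for \<theta>
    unfolding L_def kernel_chain_scale sum_distrib_left[symmetric]
    by (subst kernel_chain_trace_tensor) (auto simp: finite_verts chain_trace_def)
  have "complex_of_real (mat_trace (scaled_distance_matrix G k N ^\<^sub>m m))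
      = of_real (\<Sum>\<xi>\<in>?X. kernel_chain ?X (\<lambda>_. distance_kernel k N) m \<xi> \<xi>)"
    unfolding scaled_distance_matrix_eq[OF assms] by (subst mat_trace_pow_eq_kernel_chain[OF bij_betw_enum]) simp
  also have "\<dots> = (\<Sum>\<xi>\<in>?X. kernel_chain ?X (\<lambda>j \<xi> \<eta>. \<integral>t. L t \<xi> \<eta> \<partial>circle_measure) m \<xi> \<xi>)"
    by (simp add: of_real_kernel_chain E)
  also have "\<dots> = (\<Sum>\<xi>\<in>?X. \<integral>\<theta>. kernel_chain ?X (\<lambda>j. L (\<theta> j)) m \<xi> \<xi> \<partial>torus_measure m)"
    by (intro sum.cong refl C.kernel_chain_integral(2)[symmetric] finX int)
  also have "\<dots> = (\<integral>\<theta>. (\<Sum>\<xi>\<in>?X. kernel_chain ?X (\<lambda>j. L (\<theta> j)) m \<xi> \<xi>) \<partial>torus_measure m)"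
    by (intro Bochner_Integration.integral_sum[symmetric] C.kernel_chain_integral(1) finX int)
  also have "\<dots> = (\<integral>\<theta>. (\<Prod>j<m. 1 / circ (\<theta> j) ^ k) * chain_trace m (scale N) (\<lambda>j. circ (\<theta> j)) ^ N \<partial>torus_measure m)"
    unfolding factor ..
  finally show ?thesis .
qed

text \<open>With \<open>scale N\<close> squared equal to 1 / N, multiplication by N turns the
  second-order term into a constant, while the cubic remainder stays of order
  \<open>scale N\<close>. The constant \<open>D\<close> does not depend on s, so the estimate is
  uniform on the torus.\<close>

lemma chain_trace_scaled:
  fixes s :: "nat \<Rightarrow> complex" and N m :: nat
  assumes s: "\<And>j. norm (s j) \<le> 1" and ne: "verts G \<noteq> {}" and N: "N > 0"
  defines "D \<equiv> (\<Sum>x\<in>verts G. card (chains (verts G) m x x)) / card (verts G)"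
  shows "norm (of_nat N * (chain_trace m (scale N) s / card (verts G) - 1) - of_real mean_degree * pair_sum m s) \<le> D * scale N"
proof -
  let ?v = "card (verts G)" and ?e = "scale N"
  have v: "?v > 0" using ne finite_verts by (simp add: card_gt_0_iff)
  have e: "0 \<le> ?e" "?e \<le> 1" "?e\<^sup>2 = 1 / N" using N by (auto simp: power_divide)
  have "of_nat N * (chain_trace m ?e s / ?v - 1) - of_real mean_degree * pair_sum m s
      = of_nat N / ?v * (chain_trace m ?e s - (?v + 2 * card (edges G) * pair_sum m s * ?e\<^sup>2))"
    unfolding mean_degree_def of_real_power[symmetric] e(3) using v N by (simp add: field_simps)
  also have "norm \<dots> \<le> N / ?v * ((\<Sum>x\<in>verts G. card (chains (verts G) m x x)) * ?e ^ 3)"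
    unfolding norm_mult chain_trace_def
    using dist_chain_trace_expansion[OF s e(1,2)] by (intro mult_mono) (auto simp: norm_divide)
  also have "\<dots> = D * ?e * (N * ?e\<^sup>2)"
    by (simp add: D_def power3_eq_cube power2_eq_square)
  also have "\<dots> = D * ?e" unfolding e(3) using N by simp
  finally show ?thesis .
qed

text \<open>Dominated convergence on the torus: the rescaled deviation of the normalized trace from
  1 converges, so its N-th power converges to an exponential.\<close>

lemma torus_integral_chain_trace_limit:
  assumes ne: "verts G \<noteq> {}"
  shows "(\<lambda>N. \<integral>\<theta>. (\<Prod>j<m. 1 / circ (\<theta> j) ^ k) *
             (chain_trace m (scale N) (\<lambda>j. circ (\<theta> j)) / card (verts G)) ^ N \<partial>torus_measure m)
    \<longlonglongrightarrow> (\<integral>\<theta>. (\<Prod>j<m. 1 / circ (\<theta> j) ^ k) * exp (of_real mean_degree * pair_sum m (\<lambda>j. circ (\<theta> j))) \<partial>torus_measure m)"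
proof -
  let ?v = "card (verts G)"
  interpret T: prob_space "torus_measure m" by (rule prob_space_torus_measure)
  define D where "D = (\<Sum>x\<in>verts G. card (chains (verts G) m x x)) / real ?v"
  \<comment> \<open>Chosen so that the normalized trace is exactly
    \<open>1 + z N \<theta> / N\<close> for positive N; at N = 0 both zeroth powers are 1.\<close>
  define z where "z = (\<lambda>N \<theta>. of_nat N * (chain_trace m (scale N) (\<lambda>j. circ (\<theta> j)) / ?v - 1))"
  have base: "(chain_trace m (scale N) (\<lambda>j. circ (\<theta> j)) / ?v) ^ N = (1 + z N \<theta> / of_nat N) ^ N" for N \<theta>
    by (cases "N = 0") (auto simp: z_def)
  have D: "D \<ge> 0" by (simp add: D_def sum_nonneg)
  have z: "norm (z N \<theta> - of_real mean_degree * pair_sum m (\<lambda>j. circ (\<theta> j))) \<le> D * scale N" if "N > 0" for N \<theta>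
    unfolding z_def D_def by (intro chain_trace_scaled ne that) auto
  show ?thesis
  \<comment> \<open>The exponent bounds the norm of \<open>z N \<theta>\<close> for all N:
    \<open>pair_sum\<close> has norm at most m * m on the torus, and the remainder is at most
    \<open>D\<close> since \<open>scale N\<close> is at most 1.\<close>
  proof (rule integral_dominated_convergence[where w = "\<lambda>_. exp (mean_degree * (m * m) + D)"])
    show "(\<lambda>\<theta>. (\<Prod>j<m. 1 / circ (\<theta> j) ^ k) * exp (of_real mean_degree * pair_sum m (\<lambda>j. circ (\<theta> j)))) \<in> borel_measurable (torus_measure m)"
      unfolding pair_sum_def
      by (intro borel_measurable_times borel_measurable_prod borel_measurable_divide borel_measurable_exp_complex
          borel_measurable_power borel_measurable_sum measurable_circ_component borel_measurable_const) auto
    show "(\<lambda>\<theta>. (\<Prod>j<m. 1 / circ (\<theta> j) ^ k) * (chain_trace m (scale N) (\<lambda>j. circ (\<theta> j)) / ?v) ^ N) \<in> borel_measurable (torus_measure m)" for N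
      unfolding chain_trace_def
      by (intro borel_measurable_times borel_measurable_prod borel_measurable_divide
          borel_measurable_power borel_measurable_sum measurable_circ_component borel_measurable_const
          borel_measurable_kernel_chain) auto
    show "AE \<theta> in torus_measure m. (\<lambda>N. (\<Prod>j<m. 1 / circ (\<theta> j) ^ k) * (chain_trace m (scale N) (\<lambda>j. circ (\<theta> j)) / ?v) ^ N)
       \<longlonglongrightarrow> (\<Prod>j<m. 1 / circ (\<theta> j) ^ k) * exp (of_real mean_degree * pair_sum m (\<lambda>j. circ (\<theta> j)))"
    proof (rule AE_I2, unfold base, intro tendsto_mult_left tendsto_one_plus_div_power)
      fix \<theta> :: "nat \<Rightarrow> real"
      have "(\<lambda>N. D * (1 / sqrt (real N))) \<longlonglongrightarrow> D * 0"
        by (intro tendsto_mult_left tendsto_divide_0[OF tendsto_const]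
            filterlim_at_top_imp_at_infinity filterlim_compose[OF sqrt_at_top filterlim_real_sequentially])
      then have lim: "(\<lambda>N. D * scale N) \<longlonglongrightarrow> 0" by simp
      have "(\<lambda>N. z N \<theta> - of_real mean_degree * pair_sum m (\<lambda>j. circ (\<theta> j))) \<longlonglongrightarrow> 0"
      proof (rule Lim_null_comparison[OF _ lim])
        show "\<forall>\<^sub>F N in sequentially. norm (z N \<theta> - of_real mean_degree * pair_sum m (\<lambda>j. circ (\<theta> j))) \<le> D * scale N"
          by (rule eventually_sequentiallyI[of 1], rule z) simp
      qed
      then show "(\<lambda>N. z N \<theta>) \<longlonglongrightarrow> of_real mean_degree * pair_sum m (\<lambda>j. circ (\<theta> j))"
        by (simp add: LIM_zero_iff)
    qed
    show "AE \<theta> in torus_measure m. norm ((\<Prod>j<m. 1 / circ (\<theta> j) ^ k) * (chain_trace m (scale N) (\<lambda>j. circ (\<theta> j)) / ?v) ^ N)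
       \<le> exp (mean_degree * (m * m) + D)" for N
    proof (rule AE_I2)
      fix \<theta> :: "nat \<Rightarrow> real"
      let ?p = "pair_sum m (\<lambda>j. circ (\<theta> j))"
      have c: "norm (of_real mean_degree * ?p) \<le> mean_degree * (m * m)"
        using norm_pair_sum_le[of "\<lambda>j. circ (\<theta> j)" m]
        by (simp add: norm_mult mult_left_mono mean_degree_nonneg)
      have "norm (z N \<theta>) \<le> mean_degree * (m * m) + D"
      proof (cases "N = 0")
        case True
        then show ?thesis using D by (simp add: z_def mean_degree_nonneg)
      next
        case False
        have "norm (z N \<theta>) \<le> norm (of_real mean_degree * ?p) + norm (z N \<theta> - of_real mean_degree * ?p)"
          by (metis add.commute norm_triangle_sub)
        also have "norm (z N \<theta> - of_real mean_degree * ?p) \<le> D * scale N"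
          using z[of N \<theta>] False by simp
        also have "\<dots> \<le> D * 1"
          using D False by (intro mult_left_mono) auto
        finally show ?thesis using c by simp
      qed
      then have "norm ((1 + z N \<theta> / of_nat N) ^ N) \<le> exp (mean_degree * (m * m) + D)"
        by (rule norm_one_plus_div_power_le)
      moreover have "norm (\<Prod>j<m. 1 / circ (\<theta> j) ^ k) = 1"
        by (simp add: prod_norm[symmetric] norm_divide norm_power)
      ultimately show "norm ((\<Prod>j<m. 1 / circ (\<theta> j) ^ k) * (chain_trace m (scale N) (\<lambda>j. circ (\<theta> j)) / ?v) ^ N)
         \<le> exp (mean_degree * (m * m) + D)"
        unfolding base norm_mult by simp
    qed
  qed simp
qed

text \<open>The normalization is absorbed into the N-th power under the integral. The limit integral
  is then the Gaussian-Fourier identity with a the square root of the mean degree.\<close>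

lemma normalized_trace_limit:
  assumes ne: "verts G \<noteq> {}" and k: "k \<ge> 1"
  shows "(\<lambda>N. 1 / real (card (verts G)) ^ N * mat_trace (scaled_distance_matrix G k N ^\<^sub>m m))
    \<longlonglongrightarrow> (\<integral>x. limit_function G k x ^ m \<partial>std_normal_distribution)"
proof -
  let ?v = "card (verts G)"
  have "complex_of_real (1 / real ?v ^ N * mat_trace (scaled_distance_matrix G k N ^\<^sub>m m))
      = (\<integral>\<theta>. (\<Prod>j<m. 1 / circ (\<theta> j) ^ k) * (chain_trace m (scale N) (\<lambda>j. circ (\<theta> j)) / ?v) ^ N \<partial>torus_measure m)" for N
  proof -
    have "complex_of_real (1 / real ?v ^ N * mat_trace (scaled_distance_matrix G k N ^\<^sub>m m))
      = complex_of_real (mat_trace (scaled_distance_matrix G k N ^\<^sub>m m)) / of_nat ?v ^ N" by simp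
    also have "\<dots> = (\<integral>\<theta>. (\<Prod>j<m. 1 / circ (\<theta> j) ^ k) * chain_trace m (scale N) (\<lambda>j. circ (\<theta> j)) ^ N / of_nat ?v ^ N \<partial>torus_measure m)"
      unfolding mat_trace_scaled_distance_matrix[OF k] by (rule integral_divide_zero[symmetric])
    finally show ?thesis by (simp add: power_divide)
  qed
  moreover have "(\<integral>\<theta>. (\<Prod>j<m. 1 / circ (\<theta> j) ^ k) * exp (of_real mean_degree * pair_sum m (\<lambda>j. circ (\<theta> j))) \<partial>torus_measure m)
      = of_real (\<integral>x. limit_function G k x ^ m \<partial>std_normal_distribution)"
    using torus_integral_exp_pair_sum[where a = "sqrt mean_degree" and k = k and m = m]
    unfolding limit_function_eq[OF k] real_sqrt_pow2[OF mean_degree_nonneg] .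
  ultimately have "(\<lambda>N. complex_of_real (1 / real ?v ^ N * mat_trace (scaled_distance_matrix G k N ^\<^sub>m m)))
      \<longlonglongrightarrow> of_real (\<integral>x. limit_function G k x ^ m \<partial>std_normal_distribution)"
    using torus_integral_chain_trace_limit[OF ne, of m k] by simp
  then show ?thesis by (simp only: tendsto_of_real_iff)
qed

lemma integrable_limit_function_power:
  assumes "k \<ge> 1"
  shows "integrable std_normal_distribution (\<lambda>x. limit_function G k x ^ m)"
  unfolding limit_function_eq[OF assms] by (rule integrable_hermite_power)

text \<open>The matrix is symmetric because distances are, and its size is the N-th power of the
  number of vertices, so its moments are the normalized traces.\<close>

lemma scaled_distance_matrix_moment:
  assumes ne: "verts G \<noteq> {}" and k: "k \<ge> 1"
  shows "integrable (measure_pmf (eigenvalue_distribution (scaled_distance_matrix G k N))) (\<lambda>x. x ^ m)"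
    and "measure_pmf.expectation (eigenvalue_distribution (scaled_distance_matrix G k N)) (\<lambda>x. x ^ m)
       = 1 / real (card (verts G)) ^ N * mat_trace (scaled_distance_matrix G k N ^\<^sub>m m)"
proof -
  let ?X = "{..<N} \<rightarrow>\<^sub>E verts G"
  have card: "card ?X = card (verts G) ^ N" by (simp add: card_PiE)
  have n: "card ?X > 0" unfolding card using ne finite_verts by (simp add: card_gt_0_iff)
  have A: "scaled_distance_matrix G k N \<in> carrier_mat (card ?X) (card ?X)"
    by (simp add: scaled_distance_matrix_eq[OF k])
  have sym: "scaled_distance_matrix G k N $$ (i, j) = scaled_distance_matrix G k N $$ (j, i)"
    if "i < card ?X" "j < card ?X" for i j
    using that by (simp add: scaled_distance_matrix_eq[OF k] distance_kernel_def nat_dist_commute)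
  show "integrable (measure_pmf (eigenvalue_distribution (scaled_distance_matrix G k N))) (\<lambda>x. x ^ m)"
    by (rule eigenvalue_distribution_moment(1)[OF A sym n])
  show "measure_pmf.expectation (eigenvalue_distribution (scaled_distance_matrix G k N)) (\<lambda>x. x ^ m)
       = 1 / real (card (verts G)) ^ N * mat_trace (scaled_distance_matrix G k N ^\<^sub>m m)"
    by (subst eigenvalue_distribution_moment(2)[OF A sym n]) (simp_all add: card)
qed

end

section \<open>Convergence in moments for an arbitrary standard normal variable\<close>

theorem theorem1p1:
  fixes G :: "'a ugraph" and k :: nat and M :: "'b measure" and g :: "'b \<Rightarrow> real"
  assumes "finite_simple_graph G" and "connected_graph G" and "card (verts G) \<ge> 2"
    and "k \<ge> 1"
    and "prob_space M" and "distributed M lborel g std_normal_density"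
  shows "converges_in_moments
           (\<lambda>N. measure_pmf (eigenvalue_distribution (scaled_distance_matrix G k N)))
           (distr M borel (\<lambda>\<omega>. limit_function G k (g \<omega>)))
       \<and> (\<forall>m\<ge>1. (\<lambda>N. 1 / real (card (verts G)) ^ N * mat_trace (scaled_distance_matrix G k N ^\<^sub>m m))
             \<longlonglongrightarrow> prob_space.expectation M (\<lambda>\<omega>. limit_function G k (g \<omega>) ^ m))"
proof -
  interpret finite_connected_graph G by unfold_locales (use assms in auto)
  have ne: "verts G \<noteq> {}" using assms(3) by auto
  have g [measurable]: "g \<in> borel_measurable M"
    using distributed_measurable[OF assms(6)] by simp
  \<comment> \<open>Only the law of g matters, so expectations over \<open>M\<close> become
    integrals against \<open>std_normal_distribution\<close>.\<close>
  have distr: "distr M borel g = std_normal_distribution"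
    using distributed_distr_eq_density[OF assms(6)] by (simp cong: distr_cong)
  have [measurable]: "limit_function G k \<in> borel_measurable borel"
    unfolding limit_function_def[abs_def]
    by (intro borel_measurable_continuous_onI continuous_intros)
  have E: "prob_space.expectation M (\<lambda>\<omega>. limit_function G k (g \<omega>) ^ m)
      = (\<integral>x. limit_function G k x ^ m \<partial>std_normal_distribution)" for m
    unfolding distr[symmetric] by (subst integral_distr) auto
  have I: "integrable M (\<lambda>\<omega>. limit_function G k (g \<omega>) ^ m)" for m
    using integrable_limit_function_power[OF assms(4), of m]
    unfolding distr[symmetric] by (subst (asm) integrable_distr_eq) auto
  \<comment> \<open>Stated for every m, including 0, since \<open>converges_in_moments\<close>
    ranges over all exponents.\<close>
  have L: "(\<lambda>N. 1 / real (card (verts G)) ^ N * mat_trace (scaled_distance_matrix G k N ^\<^sub>m m))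
      \<longlonglongrightarrow> prob_space.expectation M (\<lambda>\<omega>. limit_function G k (g \<omega>) ^ m)" for m
    unfolding E by (rule normalized_trace_limit[OF ne assms(4)])
  have "integrable (distr M borel (\<lambda>\<omega>. limit_function G k (g \<omega>))) (\<lambda>x. x ^ m)" for m
    using I by (subst integrable_distr_eq) auto
  moreover have "integral\<^sup>L (distr M borel (\<lambda>\<omega>. limit_function G k (g \<omega>))) (\<lambda>x. x ^ m)
      = prob_space.expectation M (\<lambda>\<omega>. limit_function G k (g \<omega>) ^ m)" for m
    by (subst integral_distr) auto
  ultimately show ?thesis
    unfolding converges_in_moments_def
    using scaled_distance_matrix_moment[OF ne assms(4)] L by simp
qed

end
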